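(* Let $\Omega$ be a commutative semigroup and let $(L,\{\bullet_\alpha,\vee_{\alpha,\beta},\{\cdot,\cdot,\cdot\}_{\beta,\gamma},[\cdot,\cdot,\cdot]_{\alpha,\beta,\gamma}\}_{\alpha,\beta,\gamma\in\Omega})$ be an NS-Lie-Yamaguti family algebra. Then $L\otimes\mathbb K\Omega$ (with $\mathbb K\Omega$ the semigroup algebra), equipped with the operations determined by $$(x\otimes\alpha)\bullet(y\otimes\beta)=(x\bullet_\alpha y)\otimes\alpha\beta,\qquad (x\otimes\alpha)\vee(y\otimes\beta)=(x\vee_{\alpha,\beta}y)\otimes\alpha\beta,$$ $$\{x\otimes\alpha,y\otimes\beta,z\otimes\gamma\}=\{x,y,z\}_{\beta,\gamma}\otimes\alpha\beta\gamma,\qquad [x\otimes\alpha,y\otimes\beta,z\otimes\gamma]=[x,y,z]_{\alpha,\beta,\gamma}\otimes\alpha\beta\gamma$$ for all $x,y,z\in L$, $\alpha,\beta,\gamma\in\Omega$, is an NS-Lie-Yamaguti algebra. Moreover, if $L'$ is another NS-Lie-Yamaguti family algebra (indexed by $\Omega$) and $f:L\to L'$ is a morphism of NS-Lie-Yamaguti family algebras, then the map $\bar f:L\otimes\mathbb K\Omega\to L'\otimes\mathbb K\Omega$, $x\otimes\alpha\mapsto f(x)\otimes\alpha$, is a morphism between the induced NS-Lie-Yamaguti algebras.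
   Context: All vector spaces are over an algebraically closed field $\mathbb K$ of characteristic different from $2$ and $3$. **NS-Lie-Yamaguti algebra.** A vector space $A$ with bilinear operations $\bullet,\vee:A\times A\to A$, $\vee$ skew-symmetric, and trilinear operations $[\cdot,\cdot,\cdot],\{\cdot,\cdot,\cdot\}:A\times A\times A\to A$ with $[x,y,z]=-[y,x,z]$, such that, setting $[x,y]^*=x\bullet y-y\bullet x+x\vee y$, $\{x,y,z\}^*=\{z,y,x\}-\{z,x,y\}+x\bullet(y\bullet z)-y\bullet(x\bullet z)-[x,y]^*\bullet z$, $[\![x,y,z]\!]=\{x,y,z\}^*+\{x,y,z\}-\{y,x,z\}+[x,y,z]$, for all $x,y,z,a,b\in A$: $\{a,[x,y]^*,z\}-\{y\bullet a,x,z\}+\{x\bullet a,y,z\}=0$; $\{x,y,z\bullet a\}^*-z\bullet\{x,y,a\}^*-[\![x,y,z]\!]\bullet a=0$; $\{a,x,[y,z]^*\}-y\bullet\{a,x,z\}+z\bullet\{a,x,y\}=0$; $\{x,y,\{b,z,a\}\}^*-\{\{x,y,b\}^*,z,a\}-\{b,[\![x,y,z]\!],a\}-\{b,z,[\![x,y,a]\!]\}=0$; $\{b,x,[\![y,z,a]\!]\}-\{\{b,x,y\},z,a\}+\{\{b,x,z\},y,a\}-\{y,z,\{b,x,a\}\}^*=0$; $[x,y]^*\vee z+[y,z]^*\vee x+[z,x]^*\vee y-z\bullet(x\vee y)-x\bullet(y\vee z)-y\bullet(z\vee x)+[x,y,z]+[y,z,x]+[z,x,y]=0$; $\{x\vee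 y,z,a\}+\{y\vee z,x,a\}+\{z\vee x,y,a\}+[[x,y]^*,z,a]+[[y,z]^*,x,a]+[[z,x]^*,y,a]=0$; $-z\bullet[x,y,a]+a\bullet[x,y,z]+[x,y,[z,a]^*]+\{x,y,z\vee a\}^*-[\![x,y,z]\!]\vee a-z\vee[\![x,y,a]\!]=0$; $-\{[x,y,z],a,b\}+\{[x,y,a],z,b\}+\{x,y,[z,a,b]\}^*-\{z,a,[x,y,b]\}^*-[[\![x,y,z]\!],a,b]-[z,[\![x,y,a]\!],b]+[x,y,[\![z,a,b]\!]]-[z,a,[\![x,y,b]\!]]=0$. A morphism of NS-Lie-Yamaguti algebras is a linear map preserving all four operations. **NS-Lie-Yamaguti family algebra** (indexed by $\Omega$). A vector space $A$ with bilinear operations $\bullet_\alpha,\vee_{\alpha,\beta}:A\otimes A\to A$ and trilinear operations $\{\cdot,\cdot,\cdot\}_{\beta,\gamma},[\cdot,\cdot,\cdot]_{\alpha,\beta,\gamma}:A^{\otimes3}\to A$ ($\alpha,\beta,\gamma\in\Omega$) with $x\vee_{\alpha,\beta}y=-y\vee_{\beta,\alpha}x$ and $[x,y,z]_{\alpha,\beta,\gamma}=-[y,x,z]_{\beta,\alpha,\gamma}$, such that, setting $[x,y]^*_{\alpha,\beta}=x\bullet_\alpha y-y\bullet_\beta x+x\vee_{\alpha,\beta}y$, $\{x,y,z\}^*_{\alpha,\beta}=\{z,y,x\}_{\beta,\alpha}-\{z,x,y\}_{\alpha,\beta}+x\bullet_\alpha(y\bullet_\beta z)-y\bullet_\beta(x\bullet_\alpha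 z)-[x,y]^*_{\alpha,\beta}\bullet_{\alpha\beta}z$, $[\![x,y,z]\!]_{\alpha,\beta,\gamma}=\{x,y,z\}^*_{\alpha,\beta}+\{x,y,z\}_{\beta,\gamma}-\{y,x,z\}_{\alpha,\gamma}+[x,y,z]_{\alpha,\beta,\gamma}$, the following hold for all $x,y,z,a,b\in A$ and $\alpha,\beta,\gamma,\varsigma,\tau\in\Omega$: (N1) $\{a,[x,y]^*_{\alpha,\beta},z\}_{\alpha\beta,\gamma}-\{y\bullet_\beta a,x,z\}_{\alpha,\gamma}+\{x\bullet_\alpha a,y,z\}_{\beta,\gamma}=0$; (N2) $\{x,y,z\bullet_\gamma a\}^*_{\alpha,\beta}-z\bullet_\gamma\{x,y,a\}^*_{\alpha,\beta}-[\![x,y,z]\!]_{\alpha,\beta,\gamma}\bullet_{\alpha\beta\gamma}a=0$; (N3) $\{a,x,[y,z]^*_{\beta,\gamma}\}_{\alpha,\beta\gamma}-y\bullet_\beta\{a,x,z\}_{\alpha,\gamma}+z\bullet_\gamma\{a,x,y\}_{\alpha,\beta}=0$; (N4) $\{x,y,\{b,z,a\}_{\gamma,\varsigma}\}^*_{\alpha,\beta}-\{\{x,y,b\}^*_{\alpha,\beta},z,a\}_{\gamma,\varsigma}-\{b,[\![x,y,z]\!]_{\alpha,\beta,\gamma},a\}_{\alpha\beta\gamma,\varsigma}-\{b,z,[\![x,y,a]\!]_{\alpha,\beta,\varsigma}\}_{\gamma,\alpha\beta\varsigma}=0$; (N5) $\{b,x,[\![y,z,a]\!]_{\beta,\gamma,\varsigma}\}_{\alpha,\beta\gamma\varsigma}-\{\{b,x,y\}_{\alpha,\beta},z,a\}_{\gamma,\varsigma}+\{\{b,x,z\}_{\alpha,\gamma},y,a\}_{\beta,\varsigma}-\{y,z,\{b,x,a\}_{\alpha,\varsigma}\}^*_{\beta,\gamma}=0$;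 (N6) $[x,y]^*_{\alpha,\beta}\vee_{\alpha\beta,\gamma}z+[y,z]^*_{\beta,\gamma}\vee_{\beta\gamma,\alpha}x+[z,x]^*_{\gamma,\alpha}\vee_{\gamma\alpha,\beta}y-z\bullet_\gamma(x\vee_{\alpha,\beta}y)-x\bullet_\alpha(y\vee_{\beta,\gamma}z)-y\bullet_\beta(z\vee_{\gamma,\alpha}x)+[x,y,z]_{\alpha,\beta,\gamma}+[y,z,x]_{\beta,\gamma,\alpha}+[z,x,y]_{\gamma,\alpha,\beta}=0$; (N7) $\{x\vee_{\alpha,\beta}y,z,a\}_{\gamma,\varsigma}+\{y\vee_{\beta,\gamma}z,x,a\}_{\alpha,\varsigma}+\{z\vee_{\gamma,\alpha}x,y,a\}_{\beta,\varsigma}+[[x,y]^*_{\alpha,\beta},z,a]_{\alpha\beta,\gamma,\varsigma}+[[y,z]^*_{\beta,\gamma},x,a]_{\beta\gamma,\alpha,\varsigma}+[[z,x]^*_{\gamma,\alpha},y,a]_{\gamma\alpha,\beta,\varsigma}=0$; (N8) $-z\bullet_\gamma[x,y,a]_{\alpha,\beta,\varsigma}+a\bullet_\varsigma[x,y,z]_{\alpha,\beta,\gamma}+[x,y,[z,a]^*_{\gamma,\varsigma}]_{\alpha,\beta,\gamma\varsigma}+\{x,y,z\vee_{\gamma,\varsigma}a\}^*_{\alpha,\beta}-[\![x,y,z]\!]_{\alpha,\beta,\gamma}\vee_{\alpha\beta\gamma,\varsigma}a-z\vee_{\gamma,\alpha\beta\varsigma}[\![x,y,a]\!]_{\alpha,\beta,\varsigma}=0$;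 (N9) $-\{[x,y,z]_{\alpha,\beta,\gamma},a,b\}_{\varsigma,\tau}+\{[x,y,a]_{\alpha,\beta,\varsigma},z,b\}_{\gamma,\tau}+\{x,y,[z,a,b]_{\gamma,\varsigma,\tau}\}^*_{\alpha,\beta}-\{z,a,[x,y,b]_{\alpha,\beta,\tau}\}^*_{\gamma,\varsigma}-[[\![x,y,z]\!]_{\alpha,\beta,\gamma},a,b]_{\alpha\beta\gamma,\varsigma,\tau}-[z,[\![x,y,a]\!]_{\alpha,\beta,\varsigma},b]_{\gamma,\alpha\beta\varsigma,\tau}+[x,y,[\![z,a,b]\!]_{\gamma,\varsigma,\tau}]_{\alpha,\beta,\gamma\varsigma\tau}-[z,a,[\![x,y,b]\!]_{\alpha,\beta,\tau}]_{\gamma,\varsigma,\alpha\beta\tau}=0$. A morphism of NS-Lie-Yamaguti family algebras is a linear map preserving all operations $\bullet_\alpha,\vee_{\alpha,\beta},\{\cdot,\cdot,\cdot\}_{\beta,\gamma},[\cdot,\cdot,\cdot]_{\alpha,\beta,\gamma}$ for all indices. *)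

theory Defs
  imports "HOL-Library.Poly_Mapping" "HOL-Computational_Algebra.Polynomial"
begin

section \<open>Multilinear maps\<close>

definition bilinear_map ::
    "('k::field \<Rightarrow> 'u::ab_group_add \<Rightarrow> 'u) \<Rightarrow> ('k \<Rightarrow> 'v::ab_group_add \<Rightarrow> 'v) \<Rightarrow>
     ('k \<Rightarrow> 'w::ab_group_add \<Rightarrow> 'w) \<Rightarrow> ('u \<Rightarrow> 'v \<Rightarrow> 'w) \<Rightarrow> bool"
  where "bilinear_map sU sV sW B \<longleftrightarrow>
    (\<forall>y. Vector_Spaces.linear sU sW (\<lambda>x. B x y)) \<and>
    (\<forall>x. Vector_Spaces.linear sV sW (\<lambda>y. B x y))"

definition trilinear_op :: "('k::field \<Rightarrow> 'v::ab_group_add \<Rightarrow> 'v) \<Rightarrow> ('v \<Rightarrow> 'v \<Rightarrow> 'v \<Rightarrow> 'v) \<Rightarrow> bool"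
  where "trilinear_op s T \<longleftrightarrow>
    (\<forall>y z. Vector_Spaces.linear s s (\<lambda>x. T x y z)) \<and>
    (\<forall>x z. Vector_Spaces.linear s s (\<lambda>y. T x y z)) \<and>
    (\<forall>x y. Vector_Spaces.linear s s (\<lambda>z. T x y z))"


section \<open>Free vector spaces and tensor products\<close>

text \<open>
  \<open>'i \<Rightarrow>\<^sub>0 'k\<close> with \<open>free_scale\<close> is the free vector space on \<open>'i\<close>, with basis
  \<open>Poly_Mapping.single i 1\<close>. For a semigroup \<open>'i\<close> it is the underlying vector space of the
  semigroup algebra; the product of that algebra is the bilinear extension of the product of \<open>'i\<close>,
  and only the latter is needed here.
\<close>

definition free_scale :: "'k::field \<Rightarrow> ('i \<Rightarrow>\<^sub>0 'k) \<Rightarrow> ('i \<Rightarrow>\<^sub>0 'k)"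
  where "free_scale c = Poly_Mapping.map ((*) c)"

definition lin_ext ::
    "('k::field \<Rightarrow> 'v::ab_group_add \<Rightarrow> 'v) \<Rightarrow> ('i \<Rightarrow> 'v) \<Rightarrow> ('i \<Rightarrow>\<^sub>0 'k) \<Rightarrow> 'v"
  where "lin_ext s h p = (\<Sum>i\<in>Poly_Mapping.keys p. s (Poly_Mapping.lookup p i) (h i))"

definition tensor_relations ::
    "('k::field \<Rightarrow> 'v::ab_group_add \<Rightarrow> 'v) \<Rightarrow> ('k \<Rightarrow> 'w::ab_group_add \<Rightarrow> 'w) \<Rightarrow>
     ('v \<times> 'w \<Rightarrow>\<^sub>0 'k) set"
  where "tensor_relations sV sW =
    {Poly_Mapping.single (x + x', y) 1 - Poly_Mapping.single (x, y) 1
       - Poly_Mapping.single (x', y) 1 | x x' y. True} \<union>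
    {Poly_Mapping.single (x, y + y') 1 - Poly_Mapping.single (x, y) 1
       - Poly_Mapping.single (x, y') 1 | x y y'. True} \<union>
    {Poly_Mapping.single (sV c x, y) 1 - free_scale c (Poly_Mapping.single (x, y) 1) | c x y. True} \<union>
    {Poly_Mapping.single (x, sW c y) 1 - free_scale c (Poly_Mapping.single (x, y) 1) | c x y. True}"

text \<open>
  \<open>sT\<close>, \<open>t\<close> is a tensor product of \<open>V\<close> and \<open>W\<close> if the linear map from the free vector space on
  \<open>V \<times> W\<close> to \<open>T\<close> which sends \<open>(x, y)\<close> to \<open>t x y\<close> exhibits \<open>T\<close> as the quotient by the span of the
  bilinearity relations. The quotient is not formed as a type, since it depends on the scalar
  multiplications. The universal property and existence (for \<open>W\<close> free) are proved below.
\<close>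

locale tensor_product =
  V: vector_space sV + W: vector_space sW + T: vector_space sT
  for sV :: "'k::field \<Rightarrow> 'v::ab_group_add \<Rightarrow> 'v"
    and sW :: "'k \<Rightarrow> 'w::ab_group_add \<Rightarrow> 'w"
    and sT :: "'k \<Rightarrow> 't::ab_group_add \<Rightarrow> 't" +
  fixes t :: "'v \<Rightarrow> 'w \<Rightarrow> 't"
  assumes quotient_surj: "surj (lin_ext sT (case_prod t))"
    and quotient_kernel:
      "{p. lin_ext sT (case_prod t) p = 0} = module.span free_scale (tensor_relations sV sW)"

lemma lookup_free_scale [simp]:
  "Poly_Mapping.lookup (free_scale c p) i = c * Poly_Mapping.lookup p i"
  by (simp add: free_scale_def Poly_Mapping.map.rep_eq when_def)

lemma vector_space_free_scale: "vector_space (free_scale :: 'k::field \<Rightarrow> ('i \<Rightarrow>\<^sub>0 'k) \<Rightarrow> _)"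
  by unfold_locales (auto intro!: poly_mapping_eqI simp: lookup_add algebra_simps)

lemma free_scale_single [simp]:
  "free_scale c (Poly_Mapping.single i d) = Poly_Mapping.single i (c * d)"
  by (rule poly_mapping_eqI) (simp add: lookup_single when_def)

lemma lin_ext_superset:
  assumes "vector_space s" "finite A" "Poly_Mapping.keys p \<subseteq> A"
  shows "lin_ext s h p = (\<Sum>i\<in>A. s (Poly_Mapping.lookup p i) (h i))"
proof -
  interpret vector_space s by fact
  show ?thesis
    unfolding lin_ext_def
    by (rule sum.mono_neutral_left) (use assms in \<open>auto simp: in_keys_iff\<close>)
qed

lemma lin_ext_single:
  assumes "vector_space s"
  shows "lin_ext s h (Poly_Mapping.single i c) = s c (h i)"
proof -
  interpret vector_space s by fact
  show ?thesis
    by (subst lin_ext_superset[OF assms, of "{i}"]) auto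
qed

lemma linear_lin_ext:
  assumes "vector_space s"
  shows "Vector_Spaces.linear free_scale s (lin_ext s h)"
proof -
  interpret vector_space s by fact
  interpret F: vector_space "free_scale :: 'a \<Rightarrow> ('c \<Rightarrow>\<^sub>0 'a) \<Rightarrow> _"
    by (rule vector_space_free_scale)
  have add: "lin_ext s h (p + q) = lin_ext s h p + lin_ext s h q" for p q :: "'c \<Rightarrow>\<^sub>0 'a"
  proof -
    let ?A = "Poly_Mapping.keys p \<union> Poly_Mapping.keys q"
    have "lin_ext s h (p + q) = (\<Sum>i\<in>?A. s (Poly_Mapping.lookup (p + q) i) (h i))"
      by (rule lin_ext_superset[OF assms]) (auto simp: Poly_Mapping.keys_add)
    also have "\<dots> = (\<Sum>i\<in>?A. s (Poly_Mapping.lookup p i) (h i)) + (\<Sum>i\<in>?A. s (Poly_Mapping.lookup q i) (h i))"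
      by (simp add: lookup_add scale_left_distrib sum.distrib)
    also have "\<dots> = lin_ext s h p + lin_ext s h q"
      by (simp add: lin_ext_superset[OF assms, of ?A])
    finally show ?thesis .
  qed
  have scl: "lin_ext s h (free_scale c p) = s c (lin_ext s h p)" for c and p :: "'c \<Rightarrow>\<^sub>0 'a"
  proof -
    have "lin_ext s h (free_scale c p) =
        (\<Sum>i\<in>Poly_Mapping.keys p. s (Poly_Mapping.lookup (free_scale c p) i) (h i))"
      by (rule lin_ext_superset[OF assms]) (auto simp: in_keys_iff)
    then show ?thesis
      by (simp add: lin_ext_def scale_sum_right)
  qed
  show ?thesis
    by unfold_locales (auto simp: add scl)
qed

lemma lin_ext_comp:
  assumes "Vector_Spaces.linear sV sW g"
  shows "g (lin_ext sV h p) = lin_ext sW (\<lambda>i. g (h i)) p"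
proof -
  interpret Vector_Spaces.linear sV sW g by fact
  show ?thesis by (simp add: lin_ext_def sum scale)
qed

lemma bilinear_lin_ext_relations:
  assumes B: "bilinear_map sV sW sU B"
    and p: "p \<in> module.span free_scale (tensor_relations sV sW)"
  shows "lin_ext sU (case_prod B) p = 0"
proof -
  have B1: "Vector_Spaces.linear sV sU (\<lambda>x. B x y)" for y using B by (simp add: bilinear_map_def)
  have B2: "Vector_Spaces.linear sW sU (B x)" for x using B by (simp add: bilinear_map_def)
  have vs: "vector_space sU" using B1 by (simp add: Vector_Spaces.linear_iff)
  let ?g = "lin_ext sU (case_prod B)"
  interpret G: Vector_Spaces.linear free_scale sU ?g by (rule linear_lin_ext[OF vs])
  have "tensor_relations sV sW \<subseteq> {p. ?g p = 0}"
    unfolding tensor_relations_def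
    by (auto simp: G.diff lin_ext_single[OF vs] Vector_Spaces.linear_iff[THEN iffD1, OF B1]
          Vector_Spaces.linear_iff[THEN iffD1, OF B2] G.vs2.scale_one)
  moreover have "G.vs1.subspace {p. ?g p = 0}"
    by (rule G.subspace_kernel)
  ultimately show ?thesis
    using G.vs1.span_minimal p by blast
qed

context tensor_product
begin

lemma bilinear: "bilinear_map sV sW sT t"
proof -
  interpret G: Vector_Spaces.linear free_scale sT "lin_ext sT (case_prod t)"
    by (rule linear_lin_ext) unfold_locales
  have r: "lin_ext sT (case_prod t) p = 0" if "p \<in> tensor_relations sV sW" for p
    using quotient_kernel G.vs1.span_base[OF that] by blast
  note e = G.add G.diff lin_ext_single[OF T.vector_space_axioms]
  have "t (x + x') y = t x y + t x' y" for x x' y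
  proof -
    have "Poly_Mapping.single (x + x', y) 1 - Poly_Mapping.single (x, y) 1
       - Poly_Mapping.single (x', y) 1 \<in> tensor_relations sV sW"
      unfolding tensor_relations_def by blast
    from r[OF this] show ?thesis by (simp add: e algebra_simps)
  qed
  moreover have "t x (y + y') = t x y + t x y'" for x y y'
  proof -
    have "Poly_Mapping.single (x, y + y') 1 - Poly_Mapping.single (x, y) 1
       - Poly_Mapping.single (x, y') 1 \<in> tensor_relations sV sW"
      unfolding tensor_relations_def by blast
    from r[OF this] show ?thesis by (simp add: e algebra_simps)
  qed
  moreover have "t (sV c x) y = sT c (t x y)" for c x y
  proof -
    have "Poly_Mapping.single (sV c x, y) 1 - free_scale c (Poly_Mapping.single (x, y) 1)
       \<in> tensor_relations sV sW"
      unfolding tensor_relations_def by blast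
    from r[OF this] show ?thesis by (simp add: e)
  qed
  moreover have "t x (sW c y) = sT c (t x y)" for c x y
  proof -
    have "Poly_Mapping.single (x, sW c y) 1 - free_scale c (Poly_Mapping.single (x, y) 1)
       \<in> tensor_relations sV sW"
      unfolding tensor_relations_def by blast
    from r[OF this] show ?thesis by (simp add: e)
  qed
  ultimately show ?thesis
    by (auto simp: bilinear_map_def Vector_Spaces.linear_iff V.vector_space_axioms W.vector_space_axioms
          T.vector_space_axioms)
qed

theorem universal_property:
  assumes B: "bilinear_map sV sW sU B"
  shows "\<exists>!g. Vector_Spaces.linear sT sU g \<and> (\<forall>x y. g (t x y) = B x y)"
proof -
  have vs: "vector_space sU" using B by (simp add: bilinear_map_def Vector_Spaces.linear_iff)
  let ?e = "lin_ext sT (case_prod t)" and ?b = "lin_ext sU (case_prod B)"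
  interpret E: Vector_Spaces.linear free_scale sT ?e by (rule linear_lin_ext) unfold_locales
  interpret G: Vector_Spaces.linear free_scale sU ?b by (rule linear_lin_ext[OF vs])
  have wd: "?b p = ?b q" if "?e p = ?e q" for p q
  proof -
    have "?e (p - q) = 0" using that by (simp add: E.diff)
    then have "?b (p - q) = 0"
      using bilinear_lin_ext_relations[OF B] quotient_kernel by blast
    then show ?thesis by (simp add: G.diff)
  qed
  define g where "g u = ?b (inv ?e u)" for u
  have ge: "g (?e p) = ?b p" for p
    unfolding g_def by (rule wd) (simp add: surj_f_inv_f[OF quotient_surj])
  have "Vector_Spaces.linear sT sU g"
    unfolding Vector_Spaces.linear_iff
  proof (intro conjI allI)
    fix u v c
    obtain p q where "u = ?e p" "v = ?e q" using quotient_surj by (meson surjD)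
    then show "g (u + v) = g u + g v" and "g (sT c u) = sU c (g u)"
      by (simp_all only: E.add[symmetric] E.scale[symmetric] ge G.add G.scale)
  qed (rule T.vector_space_axioms vs)+
  moreover have "g (t x y) = B x y" for x y
    using ge[of "Poly_Mapping.single (x, y) 1"]
    by (simp add: lin_ext_single[OF T.vector_space_axioms] lin_ext_single[OF vs]
          vector_space.vector_space_assms(4)[OF vs])
  moreover have "h = g" if "Vector_Spaces.linear sT sU h" "\<forall>x y. h (t x y) = B x y" for h
  proof
    fix u
    obtain p where u: "u = ?e p" using quotient_surj by (metis surjD)
    have "(\<lambda>i. h (case_prod t i)) = case_prod B" using that(2) by auto
    then show "h u = g u" unfolding u ge lin_ext_comp[OF that(1)] by simp
  qed
  ultimately show ?thesis by blast
qed

end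

text \<open>The tensor product of \<open>V\<close> with a free vector space exists: take finitely supported \<open>V\<close>-valued
  functions.\<close>

theorem tensor_product_free_exists:
  fixes sV :: "'k::field \<Rightarrow> 'v::ab_group_add \<Rightarrow> 'v"
  assumes "vector_space sV"
  shows "tensor_product sV (free_scale :: 'k \<Rightarrow> ('i \<Rightarrow>\<^sub>0 'k) \<Rightarrow> _)
           (\<lambda>c. Poly_Mapping.map (sV c)) (\<lambda>x p. Poly_Mapping.map (\<lambda>c. sV c x) p)"
proof -
  interpret V: vector_space sV by fact
  let ?sT = "\<lambda>c. Poly_Mapping.map (sV c) :: ('i \<Rightarrow>\<^sub>0 'v) \<Rightarrow> _"
  let ?t = "\<lambda>x p. Poly_Mapping.map (\<lambda>c. sV c x) p :: 'i \<Rightarrow>\<^sub>0 'v"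
  have lsT [simp]: "Poly_Mapping.lookup (?sT c p) i = sV c (Poly_Mapping.lookup p i)" for c p i
    by (simp add: Poly_Mapping.map.rep_eq when_def)
  have lt [simp]: "Poly_Mapping.lookup (?t x p) i = sV (Poly_Mapping.lookup p i) x" for x p i
    by (simp add: Poly_Mapping.map.rep_eq when_def)
  interpret F: vector_space "free_scale :: 'k \<Rightarrow> ('i \<Rightarrow>\<^sub>0 'k) \<Rightarrow> _"
    by (rule vector_space_free_scale)
  interpret FF: vector_space "free_scale :: 'k \<Rightarrow> ('v \<times> ('i \<Rightarrow>\<^sub>0 'k) \<Rightarrow>\<^sub>0 'k) \<Rightarrow> _"
    by (rule vector_space_free_scale)
  interpret T: vector_space ?sT
    by unfold_locales
      (auto intro!: poly_mapping_eqI simp: lookup_add V.scale_right_distrib V.scale_left_distrib)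
  let ?e = "lin_ext ?sT (case_prod ?t)"
  let ?R = "tensor_relations sV (free_scale :: 'k \<Rightarrow> ('i \<Rightarrow>\<^sub>0 'k) \<Rightarrow> _)"
  let ?sg = "\<lambda>x y. Poly_Mapping.single (x, y) 1 :: 'v \<times> ('i \<Rightarrow>\<^sub>0 'k) \<Rightarrow>\<^sub>0 'k"
  let ?d = "\<lambda>i. Poly_Mapping.single i 1 :: 'i \<Rightarrow>\<^sub>0 'k"
  interpret E: Vector_Spaces.linear free_scale ?sT ?e by (rule linear_lin_ext) unfold_locales
  have "?t (x + x') p = ?t x p + ?t x' p" for x x' p
    by (rule poly_mapping_eqI) (unfold lookup_add lt, rule V.scale_right_distrib)
  moreover have "?t (sV c x) p = ?sT c (?t x p)" for c x p
    by (rule poly_mapping_eqI) (unfold lsT lt, simp only: V.scale_scale mult.commute)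
  moreover have "?t x (p + p') = ?t x p + ?t x p'" for x p p'
    by (rule poly_mapping_eqI) (unfold lookup_add lt, rule V.scale_left_distrib)
  moreover have "?t x (free_scale c p) = ?sT c (?t x p)" for c x p
    by (rule poly_mapping_eqI) (unfold lookup_free_scale lsT lt, simp only: V.scale_scale)
  ultimately have bil: "bilinear_map sV free_scale ?sT ?t"
    unfolding bilinear_map_def Vector_Spaces.linear_iff
    using V.vector_space_axioms F.vector_space_axioms T.vector_space_axioms by blast
  define r where "r u = (\<Sum>i\<in>Poly_Mapping.keys u. ?sg (Poly_Mapping.lookup u i) (?d i))" for u :: "'i \<Rightarrow>\<^sub>0 'v"
  have er: "?e (r u) = u" for u
    by (rule poly_mapping_eqI)
       (simp add: r_def E.sum lin_ext_single[OF T.vector_space_axioms] lookup_sum lookup_single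
         when_def in_keys_iff if_distrib[of "\<lambda>c. sV c _"] cong: if_cong)
  let ?S = "FF.span ?R"
  have rel1: "?sg (x + x') y - ?sg x y - ?sg x' y \<in> ?S" for x x' y
    by (rule FF.span_base) (unfold tensor_relations_def, blast)
  have rel2: "?sg x (y + y') - ?sg x y - ?sg x y' \<in> ?S" for x y y'
    by (rule FF.span_base) (unfold tensor_relations_def, blast)
  have rel3: "?sg (sV c x) y - free_scale c (?sg x y) \<in> ?S" for c x y
    by (rule FF.span_base) (unfold tensor_relations_def, blast)
  have rel4: "?sg x (free_scale c y) - free_scale c (?sg x y) \<in> ?S" for c x y
    by (rule FF.span_base) (unfold tensor_relations_def, blast)
  have z1: "?sg 0 y \<in> ?S" for y
    using rel3[of 0 0 y] by (simp add: FF.scale_zero_left del: free_scale_single)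
  have z2: "?sg x 0 \<in> ?S" for x
    using rel4[of x 0 0] by (simp add: FF.scale_zero_left del: free_scale_single)
  have r_sup: "(\<Sum>i\<in>A. ?sg (Poly_Mapping.lookup u i) (?d i)) - r u \<in> ?S"
    if "finite A" "Poly_Mapping.keys u \<subseteq> A" for A u
  proof -
    have "(\<Sum>i\<in>A. ?sg (Poly_Mapping.lookup u i) (?d i)) - r u
        = (\<Sum>i\<in>A - Poly_Mapping.keys u. ?sg (Poly_Mapping.lookup u i) (?d i))"
      unfolding r_def using that by (simp add: sum_diff)
    also have "\<dots> \<in> ?S"
      by (rule FF.span_sum) (use z1 in \<open>auto simp: in_keys_iff\<close>)
    finally show ?thesis .
  qed
  have r_add: "r (u + v) - r u - r v \<in> ?S" for u v
  proof -
    let ?A = "Poly_Mapping.keys u \<union> Poly_Mapping.keys v"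
    let ?q = "\<lambda>u. \<Sum>i\<in>?A. ?sg (Poly_Mapping.lookup u i) (?d i)"
    have 0: "?q (u + v) - ?q u - ?q v \<in> ?S"
      unfolding sum_subtractf[symmetric] lookup_add by (intro FF.span_sum rel1)
    have 1: "?q (u + v) - r (u + v) \<in> ?S"
      by (rule r_sup) (auto simp: Poly_Mapping.keys_add)
    have 2: "?q u - r u \<in> ?S" and 3: "?q v - r v \<in> ?S"
      by (rule r_sup; auto)+
    show ?thesis
      using FF.span_add[OF FF.span_add[OF FF.span_diff[OF 0 1] 2] 3] by (simp add: algebra_simps)
  qed
  have r_scale: "r (?sT c u) - free_scale c (r u) \<in> ?S" for c u
  proof -
    let ?A = "Poly_Mapping.keys u"
    have "(\<Sum>i\<in>?A. ?sg (Poly_Mapping.lookup (?sT c u) i) (?d i)) - free_scale c (r u) \<in> ?S"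
      unfolding r_def FF.scale_sum_right sum_subtractf[symmetric] lsT by (intro FF.span_sum rel3)
    moreover have "(\<Sum>i\<in>?A. ?sg (Poly_Mapping.lookup (?sT c u) i) (?d i)) - r (?sT c u) \<in> ?S"
      by (rule r_sup) (auto simp: in_keys_iff)
    ultimately show ?thesis
      using FF.span_diff by fastforce
  qed
  have r_single: "?sg x y - r (?t x y) \<in> ?S" for x y
  proof -
    let ?A = "Poly_Mapping.keys y"
    have sums: "?sg x (sum f A) - (\<Sum>i\<in>A. ?sg x (f i)) \<in> ?S" if "finite A" for f and A :: "'i set"
      using that
    proof induction
      case empty
      then show ?case using z2 by simp
    next
      case (insert a A)
      have "(?sg x (f a + sum f A) - ?sg x (f a) - ?sg x (sum f A)) + (?sg x (sum f A) - (\<Sum>i\<in>A. ?sg x (f i))) \<in> ?S"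
        by (intro FF.span_add rel2 insert.IH)
      then show ?case using insert.hyps by (simp add: algebra_simps)
    qed
    have y: "y = (\<Sum>i\<in>?A. free_scale (Poly_Mapping.lookup y i) (?d i))"
      by (rule poly_mapping_eqI) (auto simp: lookup_sum lookup_single when_def in_keys_iff)
    have 1: "?sg x y - (\<Sum>i\<in>?A. ?sg x (free_scale (Poly_Mapping.lookup y i) (?d i))) \<in> ?S"
      using sums[of ?A "\<lambda>i. free_scale (Poly_Mapping.lookup y i) (?d i)", folded y] by simp
    have 2: "(\<Sum>i\<in>?A. ?sg x (free_scale (Poly_Mapping.lookup y i) (?d i)))
        - (\<Sum>i\<in>?A. free_scale (Poly_Mapping.lookup y i) (?sg x (?d i))) \<in> ?S"
      unfolding sum_subtractf[symmetric] by (intro FF.span_sum rel4)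
    have 3: "(\<Sum>i\<in>?A. ?sg (sV (Poly_Mapping.lookup y i) x) (?d i))
        - (\<Sum>i\<in>?A. free_scale (Poly_Mapping.lookup y i) (?sg x (?d i))) \<in> ?S"
      unfolding sum_subtractf[symmetric] by (intro FF.span_sum rel3)
    have 4: "(\<Sum>i\<in>?A. ?sg (sV (Poly_Mapping.lookup y i) x) (?d i)) - r (?t x y) \<in> ?S"
    proof -
      have "Poly_Mapping.keys (?t x y) \<subseteq> ?A" by (auto simp: in_keys_iff)
      from r_sup[OF _ this] show ?thesis by simp
    qed
    show ?thesis
      using FF.span_add[OF FF.span_diff[OF FF.span_add[OF 1 2] 3] 4] by simp
  qed
  have pr: "p - r (?e p) \<in> ?S" for p
  proof -
    let ?M = "{p. p - r (?e p) \<in> ?S}"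
    have "FF.subspace ?M"
    proof (rule FF.subspaceI)
      show "0 \<in> ?M" by (simp add: E.zero r_def FF.span_zero)
    next
      fix p q assume p: "p \<in> ?M" and q: "q \<in> ?M"
      have "(p - r (?e p)) + (q - r (?e q)) - (r (?e p + ?e q) - r (?e p) - r (?e q)) \<in> ?S"
        by (rule FF.span_diff[OF FF.span_add r_add]) (use p q in auto)
      then show "p + q \<in> ?M" by (simp add: E.add algebra_simps)
    next
      fix c p assume p: "p \<in> ?M"
      have "free_scale c (p - r (?e p)) - (r (?sT c (?e p)) - free_scale c (r (?e p))) \<in> ?S"
        by (rule FF.span_diff[OF FF.span_scale r_scale]) (use p in auto)
      then show "free_scale c p \<in> ?M" by (simp add: E.scale FF.scale_right_diff_distrib)
    qed
    moreover have "?sg x y \<in> ?M" for x y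
      using r_single[of x y] by (simp add: lin_ext_single[OF T.vector_space_axioms])
    moreover have p: "p = (\<Sum>i\<in>Poly_Mapping.keys p. free_scale (Poly_Mapping.lookup p i) (?sg (fst i) (snd i)))"
      by (rule poly_mapping_eqI) (auto simp: lookup_sum lookup_single when_def in_keys_iff)
    ultimately have "(\<Sum>i\<in>Poly_Mapping.keys p. free_scale (Poly_Mapping.lookup p i) (?sg (fst i) (snd i))) \<in> ?M"
      by (intro FF.subspace_sum FF.subspace_scale)
    then have "p \<in> ?M" by (fold p)
    then show ?thesis by simp
  qed
  show ?thesis
  proof
    show "surj ?e" using er by (metis surjI)
    show "{p. ?e p = 0} = ?S"
    proof (intro equalityI subsetI)
      fix p assume "p \<in> {p. ?e p = 0}"
      then show "p \<in> ?S" using pr[of p] by (simp add: r_def)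
    next
      fix p assume "p \<in> ?S"
      then show "p \<in> {p. ?e p = 0}" using bilinear_lin_ext_relations[OF bil] by simp
    qed
  qed
qed


section \<open>NS-Lie-Yamaguti algebras\<close>

text \<open>The operations are written \<open>bul x y\<close> for \<open>x \<bullet> y\<close>, \<open>vee x y\<close> for \<open>x \<or> y\<close>,
  \<open>cur x y z\<close> for \<open>{x, y, z}\<close> and \<open>sqr x y z\<close> for \<open>[x, y, z]\<close>. The derived operations are
  \<open>lie\<close> for \<open>[x, y]\<close>-star, \<open>cus\<close> for \<open>{x, y, z}\<close>-star and \<open>dbr\<close> for the double bracket.\<close>

locale ns_lie_yamaguti_ops =
  fixes bul vee :: "'a::ab_group_add \<Rightarrow> 'a \<Rightarrow> 'a"
    and cur sqr :: "'a \<Rightarrow> 'a \<Rightarrow> 'a \<Rightarrow> 'a"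
begin

definition lie :: "'a \<Rightarrow> 'a \<Rightarrow> 'a"
  where "lie x y = bul x y - bul y x + vee x y"

definition cus :: "'a \<Rightarrow> 'a \<Rightarrow> 'a \<Rightarrow> 'a"
  where "cus x y z =
    cur z y x - cur z x y + bul x (bul y z) - bul y (bul x z) - bul (lie x y) z"

definition dbr :: "'a \<Rightarrow> 'a \<Rightarrow> 'a \<Rightarrow> 'a"
  where "dbr x y z = cus x y z + cur x y z - cur y x z + sqr x y z"

end

locale ns_lie_yamaguti = ns_lie_yamaguti_ops bul vee cur sqr + vector_space scale
  for scale :: "'k::field \<Rightarrow> 'a::ab_group_add \<Rightarrow> 'a"
    and bul vee :: "'a \<Rightarrow> 'a \<Rightarrow> 'a"
    and cur sqr :: "'a \<Rightarrow> 'a \<Rightarrow> 'a \<Rightarrow> 'a" +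
  assumes bilinear_bul: "bilinear_map scale scale scale bul"
    and bilinear_vee: "bilinear_map scale scale scale vee"
    and trilinear_cur: "trilinear_op scale cur"
    and trilinear_sqr: "trilinear_op scale sqr"
    and vee_skew: "vee x y = - vee y x"
    and sqr_skew: "sqr x y z = - sqr y x z"
    and NS1: "cur a (lie x y) z - cur (bul y a) x z + cur (bul x a) y z = 0"
    and NS2: "cus x y (bul z a) - bul z (cus x y a) - bul (dbr x y z) a = 0"
    and NS3: "cur a x (lie y z) - bul y (cur a x z) + bul z (cur a x y) = 0"
    and NS4: "cus x y (cur b z a) - cur (cus x y b) z a - cur b (dbr x y z) a
                - cur b z (dbr x y a) = 0"
    and NS5: "cur b x (dbr y z a) - cur (cur b x y) z a + cur (cur b x z) y a
                - cus y z (cur b x a) = 0"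
    and NS6: "vee (lie x y) z + vee (lie y z) x + vee (lie z x) y
                - bul z (vee x y) - bul x (vee y z) - bul y (vee z x)
                + sqr x y z + sqr y z x + sqr z x y = 0"
    and NS7: "cur (vee x y) z a + cur (vee y z) x a + cur (vee z x) y a
                + sqr (lie x y) z a + sqr (lie y z) x a + sqr (lie z x) y a = 0"
    and NS8: "- bul z (sqr x y a) + bul a (sqr x y z) + sqr x y (lie z a)
                + cus x y (vee z a) - vee (dbr x y z) a - vee z (dbr x y a) = 0"
    and NS9: "- cur (sqr x y z) a b + cur (sqr x y a) z b
                + cus x y (sqr z a b) - cus z a (sqr x y b)
                - sqr (dbr x y z) a b - sqr z (dbr x y a) b
                + sqr x y (dbr z a b) - sqr z a (dbr x y b) = 0"

locale ns_lie_yamaguti_morphism =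
  A: ns_lie_yamaguti sA bulA veeA curA sqrA +
  B: ns_lie_yamaguti sB bulB veeB curB sqrB +
  Vector_Spaces.linear sA sB f
  for sA :: "'k::field \<Rightarrow> 'a::ab_group_add \<Rightarrow> 'a" and bulA veeA curA sqrA
    and sB :: "'k \<Rightarrow> 'b::ab_group_add \<Rightarrow> 'b" and bulB veeB curB sqrB
    and f :: "'a \<Rightarrow> 'b" +
  assumes map_bul: "f (bulA x y) = bulB (f x) (f y)"
    and map_vee: "f (veeA x y) = veeB (f x) (f y)"
    and map_cur: "f (curA x y z) = curB (f x) (f y) (f z)"
    and map_sqr: "f (sqrA x y z) = sqrB (f x) (f y) (f z)"


section \<open>NS-Lie-Yamaguti family algebras\<close>

text \<open>The index arguments come first and are in the order of the subscripts. Note that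
  \<open>cur\<close> carries only two indices, belonging to its second and third argument.\<close>

locale ns_lie_yamaguti_family_ops =
  fixes bul :: "'o::semigroup_mult \<Rightarrow> 'a::ab_group_add \<Rightarrow> 'a \<Rightarrow> 'a"
    and vee :: "'o \<Rightarrow> 'o \<Rightarrow> 'a \<Rightarrow> 'a \<Rightarrow> 'a"
    and cur :: "'o \<Rightarrow> 'o \<Rightarrow> 'a \<Rightarrow> 'a \<Rightarrow> 'a \<Rightarrow> 'a"
    and sqr :: "'o \<Rightarrow> 'o \<Rightarrow> 'o \<Rightarrow> 'a \<Rightarrow> 'a \<Rightarrow> 'a \<Rightarrow> 'a"
begin

definition lie :: "'o \<Rightarrow> 'o \<Rightarrow> 'a \<Rightarrow> 'a \<Rightarrow> 'a"
  where "lie \<alpha> \<beta> x y = bul \<alpha> x y - bul \<beta> y x + vee \<alpha> \<beta> x y"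

definition cus :: "'o \<Rightarrow> 'o \<Rightarrow> 'a \<Rightarrow> 'a \<Rightarrow> 'a \<Rightarrow> 'a"
  where "cus \<alpha> \<beta> x y z =
    cur \<beta> \<alpha> z y x - cur \<alpha> \<beta> z x y + bul \<alpha> x (bul \<beta> y z) - bul \<beta> y (bul \<alpha> x z)
    - bul (\<alpha> * \<beta>) (lie \<alpha> \<beta> x y) z"

definition dbr :: "'o \<Rightarrow> 'o \<Rightarrow> 'o \<Rightarrow> 'a \<Rightarrow> 'a \<Rightarrow> 'a \<Rightarrow> 'a"
  where "dbr \<alpha> \<beta> \<gamma> x y z =
    cus \<alpha> \<beta> x y z + cur \<beta> \<gamma> x y z - cur \<alpha> \<gamma> y x z + sqr \<alpha> \<beta> \<gamma> x y z"

end

locale ns_lie_yamaguti_family = ns_lie_yamaguti_family_ops bul vee cur sqr + vector_space scale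
  for scale :: "'k::field \<Rightarrow> 'a::ab_group_add \<Rightarrow> 'a"
    and bul :: "'o::semigroup_mult \<Rightarrow> 'a \<Rightarrow> 'a \<Rightarrow> 'a"
    and vee :: "'o \<Rightarrow> 'o \<Rightarrow> 'a \<Rightarrow> 'a \<Rightarrow> 'a"
    and cur :: "'o \<Rightarrow> 'o \<Rightarrow> 'a \<Rightarrow> 'a \<Rightarrow> 'a \<Rightarrow> 'a"
    and sqr :: "'o \<Rightarrow> 'o \<Rightarrow> 'o \<Rightarrow> 'a \<Rightarrow> 'a \<Rightarrow> 'a \<Rightarrow> 'a" +
  assumes bilinear_bul: "bilinear_map scale scale scale (bul \<alpha>)"
    and bilinear_vee: "bilinear_map scale scale scale (vee \<alpha> \<beta>)"
    and trilinear_cur: "trilinear_op scale (cur \<beta> \<gamma>)"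
    and trilinear_sqr: "trilinear_op scale (sqr \<alpha> \<beta> \<gamma>)"
    and vee_skew: "vee \<alpha> \<beta> x y = - vee \<beta> \<alpha> y x"
    and sqr_skew: "sqr \<alpha> \<beta> \<gamma> x y z = - sqr \<beta> \<alpha> \<gamma> y x z"
    and N1: "cur (\<alpha> * \<beta>) \<gamma> a (lie \<alpha> \<beta> x y) z - cur \<alpha> \<gamma> (bul \<beta> y a) x z
               + cur \<beta> \<gamma> (bul \<alpha> x a) y z = 0"
    and N2: "cus \<alpha> \<beta> x y (bul \<gamma> z a) - bul \<gamma> z (cus \<alpha> \<beta> x y a)
               - bul (\<alpha> * \<beta> * \<gamma>) (dbr \<alpha> \<beta> \<gamma> x y z) a = 0"
    and N3: "cur \<alpha> (\<beta> * \<gamma>) a x (lie \<beta> \<gamma> y z) - bul \<beta> y (cur \<alpha> \<gamma> a x z)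
               + bul \<gamma> z (cur \<alpha> \<beta> a x y) = 0"
    and N4: "cus \<alpha> \<beta> x y (cur \<gamma> \<sigma> b z a) - cur \<gamma> \<sigma> (cus \<alpha> \<beta> x y b) z a
               - cur (\<alpha> * \<beta> * \<gamma>) \<sigma> b (dbr \<alpha> \<beta> \<gamma> x y z) a
               - cur \<gamma> (\<alpha> * \<beta> * \<sigma>) b z (dbr \<alpha> \<beta> \<sigma> x y a) = 0"
    and N5: "cur \<alpha> (\<beta> * \<gamma> * \<sigma>) b x (dbr \<beta> \<gamma> \<sigma> y z a) - cur \<gamma> \<sigma> (cur \<alpha> \<beta> b x y) z a
               + cur \<beta> \<sigma> (cur \<alpha> \<gamma> b x z) y a - cus \<beta> \<gamma> y z (cur \<alpha> \<sigma> b x a) = 0"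
    and N6: "vee (\<alpha> * \<beta>) \<gamma> (lie \<alpha> \<beta> x y) z + vee (\<beta> * \<gamma>) \<alpha> (lie \<beta> \<gamma> y z) x
               + vee (\<gamma> * \<alpha>) \<beta> (lie \<gamma> \<alpha> z x) y
               - bul \<gamma> z (vee \<alpha> \<beta> x y) - bul \<alpha> x (vee \<beta> \<gamma> y z) - bul \<beta> y (vee \<gamma> \<alpha> z x)
               + sqr \<alpha> \<beta> \<gamma> x y z + sqr \<beta> \<gamma> \<alpha> y z x + sqr \<gamma> \<alpha> \<beta> z x y = 0"
    and N7: "cur \<gamma> \<sigma> (vee \<alpha> \<beta> x y) z a + cur \<alpha> \<sigma> (vee \<beta> \<gamma> y z) x a
               + cur \<beta> \<sigma> (vee \<gamma> \<alpha> z x) y a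
               + sqr (\<alpha> * \<beta>) \<gamma> \<sigma> (lie \<alpha> \<beta> x y) z a + sqr (\<beta> * \<gamma>) \<alpha> \<sigma> (lie \<beta> \<gamma> y z) x a
               + sqr (\<gamma> * \<alpha>) \<beta> \<sigma> (lie \<gamma> \<alpha> z x) y a = 0"
    and N8: "- bul \<gamma> z (sqr \<alpha> \<beta> \<sigma> x y a) + bul \<sigma> a (sqr \<alpha> \<beta> \<gamma> x y z)
               + sqr \<alpha> \<beta> (\<gamma> * \<sigma>) x y (lie \<gamma> \<sigma> z a) + cus \<alpha> \<beta> x y (vee \<gamma> \<sigma> z a)
               - vee (\<alpha> * \<beta> * \<gamma>) \<sigma> (dbr \<alpha> \<beta> \<gamma> x y z) a
               - vee \<gamma> (\<alpha> * \<beta> * \<sigma>) z (dbr \<alpha> \<beta> \<sigma> x y a) = 0"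
    and N9: "- cur \<sigma> \<tau> (sqr \<alpha> \<beta> \<gamma> x y z) a b + cur \<gamma> \<tau> (sqr \<alpha> \<beta> \<sigma> x y a) z b
               + cus \<alpha> \<beta> x y (sqr \<gamma> \<sigma> \<tau> z a b) - cus \<gamma> \<sigma> z a (sqr \<alpha> \<beta> \<tau> x y b)
               - sqr (\<alpha> * \<beta> * \<gamma>) \<sigma> \<tau> (dbr \<alpha> \<beta> \<gamma> x y z) a b
               - sqr \<gamma> (\<alpha> * \<beta> * \<sigma>) \<tau> z (dbr \<alpha> \<beta> \<sigma> x y a) b
               + sqr \<alpha> \<beta> (\<gamma> * \<sigma> * \<tau>) x y (dbr \<gamma> \<sigma> \<tau> z a b)
               - sqr \<gamma> \<sigma> (\<alpha> * \<beta> * \<tau>) z a (dbr \<alpha> \<beta> \<tau> x y b) = 0"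

locale ns_lie_yamaguti_family_morphism =
  A: ns_lie_yamaguti_family sA bulA veeA curA sqrA +
  B: ns_lie_yamaguti_family sB bulB veeB curB sqrB +
  Vector_Spaces.linear sA sB f
  for sA :: "'k::field \<Rightarrow> 'a::ab_group_add \<Rightarrow> 'a"
    and bulA :: "'o::semigroup_mult \<Rightarrow> 'a \<Rightarrow> 'a \<Rightarrow> 'a" and veeA curA sqrA
    and sB :: "'k \<Rightarrow> 'b::ab_group_add \<Rightarrow> 'b"
    and bulB :: "'o \<Rightarrow> 'b \<Rightarrow> 'b \<Rightarrow> 'b" and veeB curB sqrB
    and f :: "'a \<Rightarrow> 'b" +
  assumes map_bul: "f (bulA \<alpha> x y) = bulB \<alpha> (f x) (f y)"
    and map_vee: "f (veeA \<alpha> \<beta> x y) = veeB \<alpha> \<beta> (f x) (f y)"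
    and map_cur: "f (curA \<beta> \<gamma> x y z) = curB \<beta> \<gamma> (f x) (f y) (f z)"
    and map_sqr: "f (sqrA \<alpha> \<beta> \<gamma> x y z) = sqrB \<alpha> \<beta> \<gamma> (f x) (f y) (f z)"


section \<open>The induced operations on the tensor product with the semigroup algebra\<close>

text \<open>\<open>elt t x \<alpha>\<close> is the pure tensor of \<open>x\<close> and the basis vector \<open>\<alpha>\<close> of the semigroup algebra.\<close>

definition elt :: "('a \<Rightarrow> ('o \<Rightarrow>\<^sub>0 'k::field) \<Rightarrow> 't) \<Rightarrow> 'a \<Rightarrow> 'o \<Rightarrow> 't"
  where "elt t x \<alpha> = t x (Poly_Mapping.single \<alpha> 1)"

definition induced_bul ::
    "('k::field \<Rightarrow> 't::ab_group_add \<Rightarrow> 't) \<Rightarrow> ('a \<Rightarrow> ('o::semigroup_mult \<Rightarrow>\<^sub>0 'k) \<Rightarrow> 't) \<Rightarrow>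
     ('o \<Rightarrow> 'a \<Rightarrow> 'a \<Rightarrow> 'a) \<Rightarrow> ('t \<Rightarrow> 't \<Rightarrow> 't) \<Rightarrow> bool"
  where "induced_bul sT t bul b \<longleftrightarrow> bilinear_map sT sT sT b \<and>
    (\<forall>x y \<alpha> \<beta>. b (elt t x \<alpha>) (elt t y \<beta>) = elt t (bul \<alpha> x y) (\<alpha> * \<beta>))"

definition induced_vee ::
    "('k::field \<Rightarrow> 't::ab_group_add \<Rightarrow> 't) \<Rightarrow> ('a \<Rightarrow> ('o::semigroup_mult \<Rightarrow>\<^sub>0 'k) \<Rightarrow> 't) \<Rightarrow>
     ('o \<Rightarrow> 'o \<Rightarrow> 'a \<Rightarrow> 'a \<Rightarrow> 'a) \<Rightarrow> ('t \<Rightarrow> 't \<Rightarrow> 't) \<Rightarrow> bool"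
  where "induced_vee sT t vee v \<longleftrightarrow> bilinear_map sT sT sT v \<and>
    (\<forall>x y \<alpha> \<beta>. v (elt t x \<alpha>) (elt t y \<beta>) = elt t (vee \<alpha> \<beta> x y) (\<alpha> * \<beta>))"

definition induced_cur ::
    "('k::field \<Rightarrow> 't::ab_group_add \<Rightarrow> 't) \<Rightarrow> ('a \<Rightarrow> ('o::semigroup_mult \<Rightarrow>\<^sub>0 'k) \<Rightarrow> 't) \<Rightarrow>
     ('o \<Rightarrow> 'o \<Rightarrow> 'a \<Rightarrow> 'a \<Rightarrow> 'a \<Rightarrow> 'a) \<Rightarrow> ('t \<Rightarrow> 't \<Rightarrow> 't \<Rightarrow> 't) \<Rightarrow> bool"
  where "induced_cur sT t cur c \<longleftrightarrow> trilinear_op sT c \<and>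
    (\<forall>x y z \<alpha> \<beta> \<gamma>. c (elt t x \<alpha>) (elt t y \<beta>) (elt t z \<gamma>) = elt t (cur \<beta> \<gamma> x y z) (\<alpha> * \<beta> * \<gamma>))"

definition induced_sqr ::
    "('k::field \<Rightarrow> 't::ab_group_add \<Rightarrow> 't) \<Rightarrow> ('a \<Rightarrow> ('o::semigroup_mult \<Rightarrow>\<^sub>0 'k) \<Rightarrow> 't) \<Rightarrow>
     ('o \<Rightarrow> 'o \<Rightarrow> 'o \<Rightarrow> 'a \<Rightarrow> 'a \<Rightarrow> 'a \<Rightarrow> 'a) \<Rightarrow> ('t \<Rightarrow> 't \<Rightarrow> 't \<Rightarrow> 't) \<Rightarrow> bool"
  where "induced_sqr sT t sqr s \<longleftrightarrow> trilinear_op sT s \<and>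
    (\<forall>x y z \<alpha> \<beta> \<gamma>. s (elt t x \<alpha>) (elt t y \<beta>) (elt t z \<gamma>) =
       elt t (sqr \<alpha> \<beta> \<gamma> x y z) (\<alpha> * \<beta> * \<gamma>))"

definition induced_map ::
    "('k::field \<Rightarrow> 't::ab_group_add \<Rightarrow> 't) \<Rightarrow> ('a \<Rightarrow> ('o \<Rightarrow>\<^sub>0 'k) \<Rightarrow> 't) \<Rightarrow>
     ('k \<Rightarrow> 'u::ab_group_add \<Rightarrow> 'u) \<Rightarrow> ('b \<Rightarrow> ('o \<Rightarrow>\<^sub>0 'k) \<Rightarrow> 'u) \<Rightarrow>
     ('a \<Rightarrow> 'b) \<Rightarrow> ('t \<Rightarrow> 'u) \<Rightarrow> bool"
  where "induced_map sT t sT' t' f g \<longleftrightarrow> Vector_Spaces.linear sT sT' g \<and>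
    (\<forall>x \<alpha>. g (elt t x \<alpha>) = elt t' (f x) \<alpha>)"

end

theory Submission
  imports Defs
begin

text \<open>
  The pure tensors \<open>x \<otimes> \<alpha>\<close> with \<open>\<alpha>\<close> a basis vector generate \<open>L \<otimes> \<bbbK>\<Omega>\<close> additively, and a family of
  linear maps \<open>h \<alpha>\<close> on \<open>L\<close> is the same as a linear map on \<open>L \<otimes> \<bbbK>\<Omega>\<close> sending \<open>x \<otimes> \<alpha>\<close> to \<open>h \<alpha> x\<close>.
  Iterating this in each argument gives the existence and uniqueness of the induced operations.
  Every axiom of an NS-Lie-Yamaguti algebra is multilinear, so it suffices to verify it on such
  pure tensors. There, all summands have the product of the indices as second factor, because \<open>\<Omega>\<close>
  is commutative, and the first factor is the corresponding family axiom.
\<close>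

section \<open>Linear maps in several arguments\<close>

lemma linear_ident: "vector_space s \<Longrightarrow> Vector_Spaces.linear s s (\<lambda>x. x)"
  by (simp add: Vector_Spaces.linear_iff)

lemma linear_plus:
  "Vector_Spaces.linear s s' f \<Longrightarrow> Vector_Spaces.linear s s' g \<Longrightarrow>
    Vector_Spaces.linear s s' (\<lambda>x. f x + g x)"
  by (auto simp: Vector_Spaces.linear_iff vector_space.vector_space_assms)

lemma linear_uminus:
  "Vector_Spaces.linear s s' f \<Longrightarrow> Vector_Spaces.linear s s' (\<lambda>x. - f x)"
  by (auto simp: Vector_Spaces.linear_iff module.scale_minus_right module_iff_vector_space)

lemma linear_minus:
  "Vector_Spaces.linear s s' f \<Longrightarrow> Vector_Spaces.linear s s' g \<Longrightarrow>
    Vector_Spaces.linear s s' (\<lambda>x. f x - g x)"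
  using linear_plus[OF _ linear_uminus] by fastforce

lemma linear_comp:
  "Vector_Spaces.linear s' s'' g \<Longrightarrow> Vector_Spaces.linear s s' f \<Longrightarrow>
    Vector_Spaces.linear s s'' (\<lambda>x. g (f x))"
  by (simp add: Vector_Spaces.linear_iff)

text \<open>The inner linear map is part of the conclusion so that backward resolution can descend
  through nested operations to the occurrence of the variable.\<close>

lemma bilinear_map_linear:
  assumes "bilinear_map sU sV sW B"
  shows "Vector_Spaces.linear s sU f \<Longrightarrow> Vector_Spaces.linear s sW (\<lambda>x. B (f x) v)"
    and "Vector_Spaces.linear s sV g \<Longrightarrow> Vector_Spaces.linear s sW (\<lambda>x. B u (g x))"
  using assms by (auto simp: bilinear_map_def Vector_Spaces.linear_iff)

lemma trilinear_op_linear: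
  assumes "trilinear_op s T" "Vector_Spaces.linear s' s f"
  shows "Vector_Spaces.linear s' s (\<lambda>x. T (f x) v w)"
    and "Vector_Spaces.linear s' s (\<lambda>x. T u (f x) w)"
    and "Vector_Spaces.linear s' s (\<lambda>x. T u v (f x))"
  using assms by (auto simp: trilinear_op_def Vector_Spaces.linear_iff)

section \<open>Tensor products with a free vector space\<close>

locale free_tensor = tensor_product sV "free_scale :: 'k \<Rightarrow> ('o \<Rightarrow>\<^sub>0 'k) \<Rightarrow> _" sT t
  for sV :: "'k::field \<Rightarrow> 'v::ab_group_add \<Rightarrow> 'v"
    and sT :: "'k \<Rightarrow> 't::ab_group_add \<Rightarrow> 't"
    and t :: "'v \<Rightarrow> ('o \<Rightarrow>\<^sub>0 'k) \<Rightarrow> 't"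
begin

abbreviation pure :: "'v \<Rightarrow> 'o \<Rightarrow> 't"  (infix \<open>\<otimes>\<close> 75)
  where "x \<otimes> \<alpha> \<equiv> elt t x \<alpha>"

lemma linear_pure: "Vector_Spaces.linear sV sT (\<lambda>x. x \<otimes> \<alpha>)"
  using bilinear by (simp add: elt_def bilinear_map_def)

lemma pure_add: "(x + y) \<otimes> \<alpha> = x \<otimes> \<alpha> + y \<otimes> \<alpha>"
  and pure_minus: "(- x) \<otimes> \<alpha> = - (x \<otimes> \<alpha>)"
  and pure_diff: "(x - y) \<otimes> \<alpha> = x \<otimes> \<alpha> - y \<otimes> \<alpha>"
  and pure_zero: "0 \<otimes> \<alpha> = 0"
proof -
  interpret P: Vector_Spaces.linear sV sT "\<lambda>x. x \<otimes> \<alpha>" by (rule linear_pure)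
  show "(x + y) \<otimes> \<alpha> = x \<otimes> \<alpha> + y \<otimes> \<alpha>" "(- x) \<otimes> \<alpha> = - (x \<otimes> \<alpha>)"
    "(x - y) \<otimes> \<alpha> = x \<otimes> \<alpha> - y \<otimes> \<alpha>" "0 \<otimes> \<alpha> = 0"
    by (fact P.add P.neg P.diff P.zero)+
qed

lemmas pure_simps = pure_add pure_minus pure_diff pure_zero

text \<open>For fixed \<open>x\<close>, the linear extension of
  \<open>\<lambda>\<alpha>. h \<alpha> x\<close> to the free space is linear in the second factor.
  Its value at \<open>p\<close> is a finite combination of the \<open>h \<alpha> x\<close>, hence
  linear in \<open>x\<close> too, and the universal property applies.\<close>

lemma ex_linear_extension:
  assumes "\<And>\<alpha>. Vector_Spaces.linear sV sW (h \<alpha>)"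
  shows "\<exists>g. Vector_Spaces.linear sT sW g \<and> (\<forall>x \<alpha>. g (x \<otimes> \<alpha>) = h \<alpha> x)"
proof -
  have W: "vector_space sW" using assms by (simp add: Vector_Spaces.linear_iff)
  have lin: "Vector_Spaces.linear free_scale sW (lin_ext sW (\<lambda>\<alpha>. h \<alpha> x))" for x
    by (rule linear_lin_ext[OF W])
  interpret Wv: vector_space sW by (rule W)
  have "Vector_Spaces.linear sV sW (\<lambda>x. lin_ext sW (\<lambda>\<alpha>. h \<alpha> x) p)" for p
    using assms
    by (auto simp: lin_ext_def Vector_Spaces.linear_iff sum.distrib Wv.scale_right_distrib
        Wv.scale_sum_right mult.commute)
  with lin have "bilinear_map sV free_scale sW (\<lambda>x. lin_ext sW (\<lambda>\<alpha>. h \<alpha> x))"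
    by (simp add: bilinear_map_def)
  from universal_property[OF this] show ?thesis
    by (auto simp: elt_def lin_ext_single[OF W])
qed

section \<open>Testing multilinear identities on pure tensors\<close>

text \<open>Every \<open>p\<close> is a finite combination of basis vectors, so \<open>g\<close>
  kills all \<open>t x p\<close>. Then \<open>g\<close> and the zero map both factor the zero
  bilinear map, and such a factorization is unique.\<close>

lemma linear_vanish:
  assumes g: "Vector_Spaces.linear sT sW g" and 0: "\<And>x \<alpha>. g (x \<otimes> \<alpha>) = 0"
  shows "g u = 0"
proof -
  interpret g: Vector_Spaces.linear sT sW g by (rule g)
  have "g (t x p) = 0" for x p
  proof -
    have "Vector_Spaces.linear free_scale sT (t x)"
      using bilinear by (simp add: bilinear_map_def)
    from linear_comp[OF g this]
    interpret gt: Vector_Spaces.linear free_scale sW "\<lambda>p. g (t x p)" .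
    have p: "p = (\<Sum>i\<in>Poly_Mapping.keys p.
        free_scale (Poly_Mapping.lookup p i) (Poly_Mapping.single i 1))"
      by (rule poly_mapping_eqI) (auto simp: lookup_sum lookup_single when_def in_keys_iff)
    have "g (t x (free_scale c (Poly_Mapping.single i 1))) = 0" for c i
      using 0[of x i] by (simp only: gt.scale elt_def g.vs2.scale_zero_right)
    then show ?thesis by (subst p) (simp only: gt.sum sum.neutral_const)
  qed
  moreover have "Vector_Spaces.linear sT sW (\<lambda>_. 0)"
    by (simp add: Vector_Spaces.linear_iff T.vector_space_axioms g.vs2.vector_space_axioms)
  moreover have "bilinear_map sV free_scale sW (\<lambda>x p. 0)"
    by (simp add: bilinear_map_def Vector_Spaces.linear_iff V.vector_space_axioms
        vector_space_free_scale g.vs2.vector_space_axioms)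
  ultimately show ?thesis
    using universal_property[of sW "\<lambda>_ _. 0"] g by metis
qed

lemma linear_eqI:
  assumes "Vector_Spaces.linear sT sW g" "Vector_Spaces.linear sT sW h"
    and "\<And>x \<alpha>. g (x \<otimes> \<alpha>) = h (x \<otimes> \<alpha>)"
  shows "g u = h u"
  using linear_vanish[OF linear_minus[OF assms(1,2)]] assms(3) by simp

text \<open>One argument at a time: with the other fixed, the first may be taken to be a pure
  tensor, and then the same is done for the second. The variants below continue up to five
  arguments, the number of variables in the longest axioms. The target space is left open so that
  maps into a second tensor product can be tested as well.\<close>

lemma multilinear_vanish2:
  assumes "\<And>v. Vector_Spaces.linear sT sW (\<lambda>u. E u v)"
    and "\<And>u. Vector_Spaces.linear sT sW (\<lambda>v. E u v)"
    and "\<And>x y \<alpha> \<beta>. E (x \<otimes> \<alpha>) (y \<otimes> \<beta>) = 0"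
  shows "E u v = 0"
  by (rule linear_vanish[where g = "\<lambda>u. E u v"]) (rule assms linear_vanish[OF assms(2)])+

lemma multilinear_vanish3:
  assumes "\<And>v w. Vector_Spaces.linear sT sW (\<lambda>u. E u v w)"
    and "\<And>u w. Vector_Spaces.linear sT sW (\<lambda>v. E u v w)"
    and "\<And>u v. Vector_Spaces.linear sT sW (\<lambda>w. E u v w)"
    and "\<And>x y z \<alpha> \<beta> \<gamma>. E (x \<otimes> \<alpha>) (y \<otimes> \<beta>) (z \<otimes> \<gamma>) = 0"
  shows "E u v w = 0"
  by (rule linear_vanish[where g = "\<lambda>u. E u v w"]) (rule assms multilinear_vanish2[OF assms(2,3)])+

lemma multilinear_vanish4:
  assumes "\<And>v w r. Vector_Spaces.linear sT sW (\<lambda>u. E u v w r)"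
    and "\<And>u w r. Vector_Spaces.linear sT sW (\<lambda>v. E u v w r)"
    and "\<And>u v r. Vector_Spaces.linear sT sW (\<lambda>w. E u v w r)"
    and "\<And>u v w. Vector_Spaces.linear sT sW (\<lambda>r. E u v w r)"
    and "\<And>x y z a \<alpha> \<beta> \<gamma> \<sigma>. E (x \<otimes> \<alpha>) (y \<otimes> \<beta>) (z \<otimes> \<gamma>) (a \<otimes> \<sigma>) = 0"
  shows "E u v w r = 0"
  by (rule linear_vanish[where g = "\<lambda>u. E u v w r"])
    (rule assms multilinear_vanish3[OF assms(2-4)])+

lemma multilinear_vanish5:
  assumes "\<And>v w r q. Vector_Spaces.linear sT sW (\<lambda>u. E u v w r q)"
    and "\<And>u w r q. Vector_Spaces.linear sT sW (\<lambda>v. E u v w r q)"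
    and "\<And>u v r q. Vector_Spaces.linear sT sW (\<lambda>w. E u v w r q)"
    and "\<And>u v w q. Vector_Spaces.linear sT sW (\<lambda>r. E u v w r q)"
    and "\<And>u v w r. Vector_Spaces.linear sT sW (\<lambda>q. E u v w r q)"
    and "\<And>x y z a b \<alpha> \<beta> \<gamma> \<sigma> \<tau>. E (x \<otimes> \<alpha>) (y \<otimes> \<beta>) (z \<otimes> \<gamma>) (a \<otimes> \<sigma>) (b \<otimes> \<tau>) = 0"
  shows "E u v w r q = 0"
  by (rule linear_vanish[where g = "\<lambda>u. E u v w r q"])
    (rule assms multilinear_vanish4[OF assms(2-5)])+

section \<open>Extending families in several arguments\<close>

text \<open>For a family of linear maps the chosen map is unique by \<open>linear_eqI\<close>.
  Having it as a function of the family allows the extension to be iterated.\<close>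

definition extend :: "('k \<Rightarrow> 'w::ab_group_add \<Rightarrow> 'w) \<Rightarrow> ('o \<Rightarrow> 'v \<Rightarrow> 'w) \<Rightarrow> 't \<Rightarrow> 'w"
  where "extend sW h = (SOME g. Vector_Spaces.linear sT sW g \<and> (\<forall>x \<alpha>. g (x \<otimes> \<alpha>) = h \<alpha> x))"

lemma
  assumes "\<And>\<alpha>. Vector_Spaces.linear sV sW (h \<alpha>)"
  shows linear_extend: "Vector_Spaces.linear sT sW (extend sW h)"
    and extend_pure: "extend sW h (x \<otimes> \<alpha>) = h \<alpha> x"
  using someI_ex[OF ex_linear_extension[OF assms]] unfolding extend_def by auto

text \<open>By uniqueness, extending commutes with sums and scalar multiples of families, since both
  sides agree on pure tensors. This preserves linearity in the other arguments while one argument is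
  extended.\<close>

lemma linear_extend_param:
  assumes h: "\<And>p \<alpha>. Vector_Spaces.linear sV sW (h p \<alpha>)"
    and lin: "\<And>\<alpha> x. Vector_Spaces.linear sP sW (\<lambda>p. h p \<alpha> x)"
  shows "Vector_Spaces.linear sP sW (\<lambda>p. extend sW (h p) u)"
proof -
  have vs: "vector_space sP" "vector_space sW" using lin by (simp_all add: Vector_Spaces.linear_iff)
  interpret W': vector_space sW by fact
  note [simp] = extend_pure[of sW, OF h]
  have "extend sW (h (p + q)) u = extend sW (h p) u + extend sW (h q) u" for p q
  proof (rule linear_eqI[of sW "extend sW (h (p + q))"
        "\<lambda>u. extend sW (h p) u + extend sW (h q) u"])
    show "Vector_Spaces.linear sT sW (\<lambda>u. extend sW (h p) u + extend sW (h q) u)"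
      by (intro linear_plus linear_extend h)
    show "Vector_Spaces.linear sT sW (extend sW (h (p + q)))"
      by (rule linear_extend[OF h])
  qed (use lin in \<open>simp add: Vector_Spaces.linear_iff\<close>)
  moreover have "extend sW (h (sP c p)) u = sW c (extend sW (h p) u)" for c p
  proof (rule linear_eqI[of sW "extend sW (h (sP c p))" "\<lambda>u. sW c (extend sW (h p) u)"])
    \<comment> \<open>Multiplication by the fixed scalar \<open>c\<close> is linear because scalars
      commute.\<close>
    show "Vector_Spaces.linear sT sW (\<lambda>u. sW c (extend sW (h p) u))"
      using linear_extend[of sW "h p", OF h]
      by (simp add: Vector_Spaces.linear_iff W'.scale_right_distrib mult.commute)
    show "Vector_Spaces.linear sT sW (extend sW (h (sP c p)))"
      by (rule linear_extend[OF h])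
  qed (use lin in \<open>simp add: Vector_Spaces.linear_iff\<close>)
  ultimately show ?thesis
    using vs by (simp add: Vector_Spaces.linear_iff)
qed

lemma ex1_bilinear_extension:
  assumes H: "\<And>\<alpha> \<beta>. bilinear_map sV sV sW (H \<alpha> \<beta>)"
  shows "\<exists>!B. bilinear_map sT sT sW B \<and> (\<forall>x y \<alpha> \<beta>. B (x \<otimes> \<alpha>) (y \<otimes> \<beta>) = H \<alpha> \<beta> x y)"
proof (rule ex_ex1I)
  have H1: "Vector_Spaces.linear sV sW (\<lambda>x. H \<alpha> \<beta> x y)"
    and H2: "Vector_Spaces.linear sV sW (\<lambda>y. H \<alpha> \<beta> x y)" for x y \<alpha> \<beta>
    using H by (auto simp: bilinear_map_def)
  \<comment> \<open>Only the second argument is extended here: this is the value at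
    \<open>x \<otimes> \<alpha>\<close> and \<open>v\<close>. The argument order makes
    \<open>B1 v\<close> a family indexed by \<alpha>, ready to be extended in turn.\<close>
  define B1 where "B1 v \<alpha> x = extend sW (\<lambda>\<beta>. H \<alpha> \<beta> x) v" for v \<alpha> x
  have B1a: "Vector_Spaces.linear sV sW (\<lambda>x. B1 v \<alpha> x)" for v \<alpha>
    unfolding B1_def by (intro linear_extend_param H1 H2)
  have B1b: "Vector_Spaces.linear sT sW (\<lambda>v. B1 v \<alpha> x)" for \<alpha> x
    unfolding B1_def by (intro linear_extend H2)
  have "bilinear_map sT sT sW (\<lambda>u v. extend sW (B1 v) u)"
    unfolding bilinear_map_def by (intro conjI allI linear_extend linear_extend_param B1a B1b)
  moreover have "extend sW (B1 (y \<otimes> \<beta>)) (x \<otimes> \<alpha>) = H \<alpha> \<beta> x y" for x y \<alpha> \<beta>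
    by (simp add: extend_pure[of sW, OF B1a] B1_def extend_pure[of sW, OF H2])
  ultimately show "\<exists>B. bilinear_map sT sT sW B \<and> (\<forall>x y \<alpha> \<beta>. B (x \<otimes> \<alpha>) (y \<otimes> \<beta>) = H \<alpha> \<beta> x y)"
    by blast
next
  fix B B'
  assume B: "bilinear_map sT sT sW B \<and> (\<forall>x y \<alpha> \<beta>. B (x \<otimes> \<alpha>) (y \<otimes> \<beta>) = H \<alpha> \<beta> x y)"
    and B': "bilinear_map sT sT sW B' \<and> (\<forall>x y \<alpha> \<beta>. B' (x \<otimes> \<alpha>) (y \<otimes> \<beta>) = H \<alpha> \<beta> x y)"
  have "B u v - B' u v = 0" for u v
    by (rule multilinear_vanish2[where E = "\<lambda>u v. B u v - B' u v"])
      (use B B' in \<open>auto simp: bilinear_map_def intro!: linear_minus\<close>)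
  then show "B = B'" by (intro ext) simp
qed

text \<open>The arguments are extended from the last to the first. Each stage is shown linear in the
  argument extended next and in all the others, so that the final map is trilinear.\<close>

lemma ex1_trilinear_extension:
  assumes H1: "\<And>\<alpha> \<beta> \<gamma> y z. Vector_Spaces.linear sV sT (\<lambda>x. H \<alpha> \<beta> \<gamma> x y z)"
    and H2: "\<And>\<alpha> \<beta> \<gamma> x z. Vector_Spaces.linear sV sT (\<lambda>y. H \<alpha> \<beta> \<gamma> x y z)"
    and H3: "\<And>\<alpha> \<beta> \<gamma> x y. Vector_Spaces.linear sV sT (\<lambda>z. H \<alpha> \<beta> \<gamma> x y z)"
  shows "\<exists>!B. trilinear_op sT B \<and>
    (\<forall>x y z \<alpha> \<beta> \<gamma>. B (x \<otimes> \<alpha>) (y \<otimes> \<beta>) (z \<otimes> \<gamma>) = H \<alpha> \<beta> \<gamma> x y z)"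
proof (rule ex_ex1I)
  define B1 where "B1 w \<alpha> x \<beta> y = extend sT (\<lambda>\<gamma>. H \<alpha> \<beta> \<gamma> x y) w" for w \<alpha> x \<beta> y
  \<comment> \<open>The second and third arguments are now arbitrary, while the first is still the
    pure tensor \<open>x \<otimes> \<alpha>\<close>.\<close>
  define B2 where "B2 v w \<alpha> x = extend sT (B1 w \<alpha> x) v" for v w \<alpha> x
  have B1a: "Vector_Spaces.linear sV sT (\<lambda>y. B1 w \<alpha> x \<beta> y)" for w \<alpha> x \<beta>
    unfolding B1_def by (intro linear_extend_param H2 H3)
  have B1b: "Vector_Spaces.linear sV sT (\<lambda>x. B1 w \<alpha> x \<beta> y)" for w \<alpha> \<beta> y
    unfolding B1_def by (intro linear_extend_param H1 H3)
  have B1c: "Vector_Spaces.linear sT sT (\<lambda>w. B1 w \<alpha> x \<beta> y)" for \<alpha> x \<beta> y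
    unfolding B1_def by (intro linear_extend H3)
  have B2a: "Vector_Spaces.linear sV sT (\<lambda>x. B2 v w \<alpha> x)" for v w \<alpha>
    unfolding B2_def by (intro linear_extend_param B1a B1b)
  have B2b: "Vector_Spaces.linear sT sT (\<lambda>v. B2 v w \<alpha> x)" for w \<alpha> x
    unfolding B2_def by (intro linear_extend B1a)
  have B2c: "Vector_Spaces.linear sT sT (\<lambda>w. B2 v w \<alpha> x)" for v \<alpha> x
    unfolding B2_def by (intro linear_extend_param B1a B1c)
  have "trilinear_op sT (\<lambda>u v w. extend sT (B2 v w) u)"
    unfolding trilinear_op_def
    by (intro conjI allI linear_extend linear_extend_param B2a B2b B2c)
  moreover have "extend sT (B2 (y \<otimes> \<beta>) (z \<otimes> \<gamma>)) (x \<otimes> \<alpha>) = H \<alpha> \<beta> \<gamma> x y z" for x y z \<alpha> \<beta> \<gamma>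
    by (simp add: extend_pure[of sT, OF B2a] B2_def extend_pure[of sT, OF B1a] B1_def
        extend_pure[of sT, OF H3])
  ultimately show "\<exists>B. trilinear_op sT B \<and>
      (\<forall>x y z \<alpha> \<beta> \<gamma>. B (x \<otimes> \<alpha>) (y \<otimes> \<beta>) (z \<otimes> \<gamma>) = H \<alpha> \<beta> \<gamma> x y z)"
    by (intro exI[of _ "\<lambda>u v w. extend sT (B2 v w) u"] conjI allI)
next
  fix B B'
  assume B: "trilinear_op sT B \<and> (\<forall>x y z \<alpha> \<beta> \<gamma>. B (x \<otimes> \<alpha>) (y \<otimes> \<beta>) (z \<otimes> \<gamma>) = H \<alpha> \<beta> \<gamma> x y z)"
    and B': "trilinear_op sT B' \<and> (\<forall>x y z \<alpha> \<beta> \<gamma>. B' (x \<otimes> \<alpha>) (y \<otimes> \<beta>) (z \<otimes> \<gamma>) = H \<alpha> \<beta> \<gamma> x y z)"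
  have "B u v w - B' u v w = 0" for u v w
    by (rule multilinear_vanish3[where E = "\<lambda>u v w. B u v w - B' u v w"])
      (use B B' in \<open>auto simp: trilinear_op_def intro!: linear_minus\<close>)
  then show "B = B'" by (intro ext) simp
qed

text \<open>For each \<alpha>, sending \<open>x\<close> to the pure tensor of \<open>f x\<close> and
  \<alpha> is a composite of linear maps; the extension of this family is the required map.\<close>

lemma ex1_induced_map:
  assumes "free_tensor sV' sT' t'" "Vector_Spaces.linear sV sV' f"
  shows "\<exists>!g. induced_map sT t sT' t' f g"
proof (rule ex_ex1I)
  interpret T': free_tensor sV' sT' t' by fact
  show "\<exists>g. induced_map sT t sT' t' f g"
    using ex_linear_extension[of sT' "\<lambda>\<alpha> x. elt t' (f x) \<alpha>"] linear_comp[OF T'.linear_pure assms(2)]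
    by (simp add: induced_map_def)
next
  fix g g' assume "induced_map sT t sT' t' f g" "induced_map sT t sT' t' f g'"
  then show "g = g'"
    unfolding induced_map_def by (intro ext) (rule linear_eqI[of sT' g g'], auto)
qed

end

section \<open>The induced algebra\<close>

locale family_tensor =
  F: ns_lie_yamaguti_family sL bul vee cur sqr + free_tensor sL sT t
  for sL :: "'k::field \<Rightarrow> 'a::ab_group_add \<Rightarrow> 'a"
    and bul :: "'o::semigroup_mult \<Rightarrow> 'a \<Rightarrow> 'a \<Rightarrow> 'a"
    and vee cur sqr
    and sT :: "'k \<Rightarrow> 't::ab_group_add \<Rightarrow> 't"
    and t :: "'a \<Rightarrow> ('o \<Rightarrow>\<^sub>0 'k) \<Rightarrow> 't"
begin

section \<open>Existence and uniqueness of the induced operations\<close>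

text \<open>For fixed indices the prescribed value is a family operation followed by tensoring with
  a fixed basis vector, hence multilinear. The same reason serves the other three
  operations.\<close>

lemma ex1_induced_bul: "\<exists>!b. induced_bul sT t bul b"
  unfolding induced_bul_def
  by (rule ex1_bilinear_extension)
    (simp only: bilinear_map_def, intro conjI allI linear_comp[OF linear_pure]
      bilinear_map_linear[OF F.bilinear_bul] linear_ident[OF F.vector_space_axioms])

lemma ex1_induced_vee: "\<exists>!v. induced_vee sT t vee v"
  unfolding induced_vee_def
  by (rule ex1_bilinear_extension)
    (simp only: bilinear_map_def, intro conjI allI linear_comp[OF linear_pure]
      bilinear_map_linear[OF F.bilinear_vee] linear_ident[OF F.vector_space_axioms])

lemma ex1_induced_cur: "\<exists>!c. induced_cur sT t cur c"
  unfolding induced_cur_def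
  by (rule ex1_trilinear_extension)
    (intro linear_comp[OF linear_pure] trilinear_op_linear[OF F.trilinear_cur]
      linear_ident[OF F.vector_space_axioms])+

lemma ex1_induced_sqr: "\<exists>!s. induced_sqr sT t sqr s"
  unfolding induced_sqr_def
  by (rule ex1_trilinear_extension)
    (intro linear_comp[OF linear_pure] trilinear_op_linear[OF F.trilinear_sqr]
      linear_ident[OF F.vector_space_axioms])+

end

text \<open>The operations are any with the prescribed values rather than a chosen construction, so
  that two such algebras can be compared later. \<Omega> is commutative from here on because the
  summands of one identity list their indices in different orders.\<close>

locale induced_algebra = family_tensor sL bul vee cur sqr sT t + O: ns_lie_yamaguti_ops b v c s
  for sL :: "'k::field \<Rightarrow> 'a::ab_group_add \<Rightarrow> 'a"
    and bul :: "'o::ab_semigroup_mult \<Rightarrow> 'a \<Rightarrow> 'a \<Rightarrow> 'a"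
    and vee cur sqr
    and sT :: "'k \<Rightarrow> 't::ab_group_add \<Rightarrow> 't"
    and t :: "'a \<Rightarrow> ('o \<Rightarrow>\<^sub>0 'k) \<Rightarrow> 't"
    and b v :: "'t \<Rightarrow> 't \<Rightarrow> 't"
    and c s :: "'t \<Rightarrow> 't \<Rightarrow> 't \<Rightarrow> 't" +
  assumes b: "induced_bul sT t bul b" and v: "induced_vee sT t vee v"
    and c: "induced_cur sT t cur c" and s: "induced_sqr sT t sqr s"
begin

lemma op_pure:
  "b (x \<otimes> \<alpha>) (y \<otimes> \<beta>) = bul \<alpha> x y \<otimes> (\<alpha> * \<beta>)"
  "v (x \<otimes> \<alpha>) (y \<otimes> \<beta>) = vee \<alpha> \<beta> x y \<otimes> (\<alpha> * \<beta>)"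
  "c (x \<otimes> \<alpha>) (y \<otimes> \<beta>) (z \<otimes> \<gamma>) = cur \<beta> \<gamma> x y z \<otimes> (\<alpha> * \<beta> * \<gamma>)"
  "s (x \<otimes> \<alpha>) (y \<otimes> \<beta>) (z \<otimes> \<gamma>) = sqr \<alpha> \<beta> \<gamma> x y z \<otimes> (\<alpha> * \<beta> * \<gamma>)"
  using b v c s by (auto simp: induced_bul_def induced_vee_def induced_cur_def induced_sqr_def)

lemma op_multilinear:
  "bilinear_map sT sT sT b" "bilinear_map sT sT sT v" "trilinear_op sT c" "trilinear_op sT s"
  using b v c s by (auto simp: induced_bul_def induced_vee_def induced_cur_def induced_sqr_def)

text \<open>Each variable occurs exactly once in every summand of the expressions to be treated, so
  these rules contain none for constant maps.\<close>

lemmas linear_op_intros =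
  linear_plus linear_minus linear_uminus linear_ident[OF T.vector_space_axioms]
  bilinear_map_linear[OF op_multilinear(1)] bilinear_map_linear[OF op_multilinear(2)]
  trilinear_op_linear[OF op_multilinear(3)] trilinear_op_linear[OF op_multilinear(4)]

text \<open>With the derived operations known to be multilinear, the axioms can be treated without
  unfolding them.\<close>

lemma bilinear_lie: "bilinear_map sT sT sT O.lie"
  unfolding bilinear_map_def O.lie_def by (intro conjI allI linear_op_intros)

lemma trilinear_cus: "trilinear_op sT O.cus"
  unfolding trilinear_op_def O.cus_def
  by (intro conjI allI linear_op_intros bilinear_map_linear[OF bilinear_lie])

lemma trilinear_dbr: "trilinear_op sT O.dbr"
  unfolding trilinear_op_def O.dbr_def
  by (intro conjI allI linear_op_intros trilinear_op_linear[OF trilinear_cus])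

lemmas linear_intros = linear_op_intros bilinear_map_linear[OF bilinear_lie]
  trilinear_op_linear[OF trilinear_cus] trilinear_op_linear[OF trilinear_dbr]

text \<open>The terms for \<open>x\<close>, \<open>y\<close> and for \<open>y\<close>,
  \<open>x\<close> carry the second factors \<open>\<alpha> * \<beta>\<close> and
  \<open>\<beta> * \<alpha>\<close>, which commutativity identifies.\<close>

lemma lie_pure: "O.lie (x \<otimes> \<alpha>) (y \<otimes> \<beta>) = F.lie \<alpha> \<beta> x y \<otimes> (\<alpha> * \<beta>)"
  by (simp add: O.lie_def F.lie_def op_pure pure_simps mult.commute)

text \<open>In the summands built from \<open>c\<close> the element \<open>z\<close> stands first,
  and \<open>cur\<close> has no subscript for that slot; so \<gamma> survives only in the second
  factor, as it should for \<open>F.cus\<close>.\<close>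

lemma cus_pure: "O.cus (x \<otimes> \<alpha>) (y \<otimes> \<beta>) (z \<otimes> \<gamma>) = F.cus \<alpha> \<beta> x y z \<otimes> (\<alpha> * \<beta> * \<gamma>)"
  by (simp add: O.cus_def F.cus_def op_pure lie_pure pure_simps mult_ac)

lemma dbr_pure: "O.dbr (x \<otimes> \<alpha>) (y \<otimes> \<beta>) (z \<otimes> \<gamma>) = F.dbr \<alpha> \<beta> \<gamma> x y z \<otimes> (\<alpha> * \<beta> * \<gamma>)"
  by (simp add: O.dbr_def F.dbr_def op_pure cus_pure pure_simps mult_ac)

lemmas all_pure = op_pure lie_pure cus_pure dbr_pure

section \<open>Verification of the axioms\<close>

theorem ns_lie_yamaguti: "ns_lie_yamaguti sT b v c s"
proof
  show "v x y = - v y x" for x y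
  proof -
    \<comment> \<open>Stated as a vanishing bilinear expression to fit the test on pure tensors. The
      family law is applied by a single \<open>subst\<close>, since as a rewrite rule it would apply
      again to its own result.\<close>
    have "v x y + v y x = 0" (is "?E x y = 0") for x y
      by (rule multilinear_vanish2[where sW = sT and E = ?E]; (intro linear_intros)?)
        (simp only: op_pure, subst F.vee_skew, simp add: pure_minus mult_ac)
    then show ?thesis by (simp add: eq_neg_iff_add_eq_0)
  qed
  show "s x y z = - s y x z" for x y z
  proof -
    have "s x y z + s y x z = 0" (is "?E x y z = 0") for x y z
      by (rule multilinear_vanish3[where sW = sT and E = ?E]; (intro linear_intros)?)
        (simp only: op_pure, subst F.sqr_skew, simp add: pure_minus mult_ac)
    then show ?thesis by (simp add: eq_neg_iff_add_eq_0)
  qed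
  show "c a (O.lie x y) z - c (b y a) x z + c (b x a) y z = 0"
    (is "?E x y z a = 0") for x y z a
  \<comment> \<open>Resolution with \<open>linear_intros\<close> settles linearity in each variable;
    the optional method leaves only the goal on pure tensors.\<close>
  proof (rule multilinear_vanish4[where sW = sT and E = ?E]; (intro linear_intros)?)
    fix x y z a \<alpha> \<beta> \<gamma> \<sigma>
    \<comment> \<open>The family axiom is tensored with the product of all indices, the common
      second factor of the summands. The index \<sigma> of \<open>a\<close> occurs only in that
      product; \<open>mult_ac\<close> also normalizes the products inside subscripts.\<close>
    show "?E (x \<otimes> \<alpha>) (y \<otimes> \<beta>) (z \<otimes> \<gamma>) (a \<otimes> \<sigma>) = 0"
      using arg_cong[OF F.N1[of \<alpha> \<beta> \<gamma> a x y z], of "\<lambda>w. w \<otimes> (\<alpha> * \<beta> * \<gamma> * \<sigma>)"]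
      by (simp only: all_pure pure_simps mult_ac)
  qed
  show "O.cus x y (b z a) - b z (O.cus x y a) - b (O.dbr x y z) a = 0"
    (is "?E x y z a = 0") for x y z a
  proof (rule multilinear_vanish4[where sW = sT and E = ?E]; (intro linear_intros)?)
    fix x y z a \<alpha> \<beta> \<gamma> \<sigma>
    show "?E (x \<otimes> \<alpha>) (y \<otimes> \<beta>) (z \<otimes> \<gamma>) (a \<otimes> \<sigma>) = 0"
      using arg_cong[OF F.N2[of \<alpha> \<beta> x y \<gamma> z a], of "\<lambda>w. w \<otimes> (\<alpha> * \<beta> * \<gamma> * \<sigma>)"]
      by (simp only: all_pure pure_simps mult_ac)
  qed
  show "c a x (O.lie y z) - b y (c a x z) + b z (c a x y) = 0"
    (is "?E x y z a = 0") for x y z a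
  proof (rule multilinear_vanish4[where sW = sT and E = ?E]; (intro linear_intros)?)
    fix x y z a \<alpha> \<beta> \<gamma> \<sigma>
    show "?E (x \<otimes> \<alpha>) (y \<otimes> \<beta>) (z \<otimes> \<gamma>) (a \<otimes> \<sigma>) = 0"
      using arg_cong[OF F.N3[of \<alpha> \<beta> \<gamma> a x y z], of "\<lambda>w. w \<otimes> (\<alpha> * \<beta> * \<gamma> * \<sigma>)"]
      by (simp only: all_pure pure_simps mult_ac)
  qed
  show "O.cus x y (c d z a) - c (O.cus x y d) z a - c d (O.dbr x y z) a
        - c d z (O.dbr x y a) = 0"
    (is "?E x y z a d = 0") for x y z a d
  proof (rule multilinear_vanish5[where sW = sT and E = ?E]; (intro linear_intros)?)
    fix x y z a d \<alpha> \<beta> \<gamma> \<sigma> \<tau>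
    \<comment> \<open>The element \<open>d\<close> sits in the first slot of \<open>c\<close>,
      directly or inside \<open>O.cus\<close>, so its index \<tau> enters only through the second
      factor.\<close>
    show "?E (x \<otimes> \<alpha>) (y \<otimes> \<beta>) (z \<otimes> \<gamma>) (a \<otimes> \<sigma>) (d \<otimes> \<tau>) = 0"
      using arg_cong[OF F.N4[of \<alpha> \<beta> x y \<gamma> \<sigma> d z a], of "\<lambda>w. w \<otimes> (\<alpha> * \<beta> * \<gamma> * \<sigma> * \<tau>)"]
      by (simp only: all_pure pure_simps mult_ac)
  qed
  show "c d x (O.dbr y z a) - c (c d x y) z a + c (c d x z) y a - O.cus y z (c d x a) = 0"
    (is "?E x y z a d = 0") for x y z a d
  proof (rule multilinear_vanish5[where sW = sT and E = ?E]; (intro linear_intros)?)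
    fix x y z a d \<alpha> \<beta> \<gamma> \<sigma> \<tau>
    show "?E (x \<otimes> \<alpha>) (y \<otimes> \<beta>) (z \<otimes> \<gamma>) (a \<otimes> \<sigma>) (d \<otimes> \<tau>) = 0"
      using arg_cong[OF F.N5[of \<alpha> \<beta> \<gamma> \<sigma> d x y z a], of "\<lambda>w. w \<otimes> (\<alpha> * \<beta> * \<gamma> * \<sigma> * \<tau>)"]
      by (simp only: all_pure pure_simps mult_ac)
  qed
  show "v (O.lie x y) z + v (O.lie y z) x + v (O.lie z x) y - b z (v x y) - b x (v y z)
        - b y (v z x) + s x y z + s y z x + s z x y = 0"
    (is "?E x y z = 0") for x y z
  proof (rule multilinear_vanish3[where sW = sT and E = ?E]; (intro linear_intros)?)
    fix x y z \<alpha> \<beta> \<gamma>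
    \<comment> \<open>Rotating the three elements rotates their indices as well, which leaves the
      product unchanged by commutativity.\<close>
    show "?E (x \<otimes> \<alpha>) (y \<otimes> \<beta>) (z \<otimes> \<gamma>) = 0"
      using arg_cong[OF F.N6[of \<alpha> \<beta> \<gamma> x y z], of "\<lambda>w. w \<otimes> (\<alpha> * \<beta> * \<gamma>)"]
      by (simp only: all_pure pure_simps mult_ac)
  qed
  show "c (v x y) z a + c (v y z) x a + c (v z x) y a + s (O.lie x y) z a
        + s (O.lie y z) x a + s (O.lie z x) y a = 0"
    (is "?E x y z a = 0") for x y z a
  proof (rule multilinear_vanish4[where sW = sT and E = ?E]; (intro linear_intros)?)
    fix x y z a \<alpha> \<beta> \<gamma> \<sigma>
    show "?E (x \<otimes> \<alpha>) (y \<otimes> \<beta>) (z \<otimes> \<gamma>) (a \<otimes> \<sigma>) = 0"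
      using arg_cong[OF F.N7[of \<gamma> \<sigma> \<alpha> \<beta> x y z a], of "\<lambda>w. w \<otimes> (\<alpha> * \<beta> * \<gamma> * \<sigma>)"]
      by (simp only: all_pure pure_simps mult_ac)
  qed
  show "- b z (s x y a) + b a (s x y z) + s x y (O.lie z a) + O.cus x y (v z a)
        - v (O.dbr x y z) a - v z (O.dbr x y a) = 0"
    (is "?E x y z a = 0") for x y z a
  proof (rule multilinear_vanish4[where sW = sT and E = ?E]; (intro linear_intros)?)
    fix x y z a \<alpha> \<beta> \<gamma> \<sigma>
    show "?E (x \<otimes> \<alpha>) (y \<otimes> \<beta>) (z \<otimes> \<gamma>) (a \<otimes> \<sigma>) = 0"
      using arg_cong[OF F.N8[of \<gamma> z \<alpha> \<beta> \<sigma> x y a], of "\<lambda>w. w \<otimes> (\<alpha> * \<beta> * \<gamma> * \<sigma>)"]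
      by (simp only: all_pure pure_simps mult_ac)
  qed
  show "- c (s x y z) a d + c (s x y a) z d + O.cus x y (s z a d) - O.cus z a (s x y d)
        - s (O.dbr x y z) a d - s z (O.dbr x y a) d + s x y (O.dbr z a d)
        - s z a (O.dbr x y d) = 0"
    (is "?E x y z a d = 0") for x y z a d
  proof (rule multilinear_vanish5[where sW = sT and E = ?E]; (intro linear_intros)?)
    fix x y z a d \<alpha> \<beta> \<gamma> \<sigma> \<tau>
    \<comment> \<open>Summands in which \<open>z\<close> and \<open>a\<close> come before
      \<open>x\<close> and \<open>y\<close> have the factors of the total index in another order;
      normalization makes them equal.\<close>
    show "?E (x \<otimes> \<alpha>) (y \<otimes> \<beta>) (z \<otimes> \<gamma>) (a \<otimes> \<sigma>) (d \<otimes> \<tau>) = 0"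
      using arg_cong[OF F.N9[of \<sigma> \<tau> \<alpha> \<beta> \<gamma> x y z a d], of "\<lambda>w. w \<otimes> (\<alpha> * \<beta> * \<gamma> * \<sigma> * \<tau>)"]
      by (simp only: all_pure pure_simps mult_ac)
  qed
\<comment> \<open>What remains is the multilinearity of the four operations, which is part of their
  characterization.\<close>
qed (rule op_multilinear)+

end

section \<open>Functoriality\<close>

text \<open>The difference of the two sides of each morphism condition is multilinear with values in
  the second tensor product. On pure tensors it vanishes, because \<open>f\<close> respects the
  family operations index by index and \<open>g\<close> keeps the second factor.\<close>

lemma induced_morphism:
  assumes "ns_lie_yamaguti_family_morphism sL bul vee cur sqr sL' bul' vee' cur' sqr' f"
    and "induced_algebra sL bul vee cur sqr sT t b v c s"
    and "induced_algebra sL' bul' vee' cur' sqr' sT' t' b' v' c' s'"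
    and "induced_map sT t sT' t' f g"
  shows "ns_lie_yamaguti_morphism sT b v c s sT' b' v' c' s' g"
proof -
  interpret f: ns_lie_yamaguti_family_morphism sL bul vee cur sqr sL' bul' vee' cur' sqr' f by fact
  interpret I: induced_algebra sL bul vee cur sqr sT t b v c s by fact
  interpret I': induced_algebra sL' bul' vee' cur' sqr' sT' t' b' v' c' s' by fact
  interpret A: ns_lie_yamaguti sT b v c s by (rule I.ns_lie_yamaguti)
  interpret B: ns_lie_yamaguti sT' b' v' c' s' by (rule I'.ns_lie_yamaguti)
  have lin: "Vector_Spaces.linear sT sT' g" and g: "g (elt t x \<alpha>) = elt t' (f x) \<alpha>" for x \<alpha>
    using assms(4) by (auto simp: induced_map_def)
  interpret g: Vector_Spaces.linear sT sT' g by (rule lin)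
  note intros = linear_minus linear_comp[OF lin] I.linear_op_intros lin
    bilinear_map_linear[OF I'.op_multilinear(1)] bilinear_map_linear[OF I'.op_multilinear(2)]
    trilinear_op_linear[OF I'.op_multilinear(3)] trilinear_op_linear[OF I'.op_multilinear(4)]
  note pures = g I.op_pure I'.op_pure f.map_bul f.map_vee f.map_cur f.map_sqr
  have "g (b x y) - b' (g x) (g y) = 0" (is "?E x y = 0") for x y
    by (rule I.multilinear_vanish2[where sW = sT' and E = ?E]; (intro intros)?) (simp add: pures)
  moreover have "g (v x y) - v' (g x) (g y) = 0" (is "?E x y = 0") for x y
    by (rule I.multilinear_vanish2[where sW = sT' and E = ?E]; (intro intros)?) (simp add: pures)
  moreover have "g (c x y z) - c' (g x) (g y) (g z) = 0" (is "?E x y z = 0") for x y z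
    by (rule I.multilinear_vanish3[where sW = sT' and E = ?E]; (intro intros)?) (simp add: pures)
  moreover have "g (s x y z) - s' (g x) (g y) (g z) = 0" (is "?E x y z = 0") for x y z
    by (rule I.multilinear_vanish3[where sW = sT' and E = ?E]; (intro intros)?) (simp add: pures)
  ultimately show ?thesis
    by unfold_locales auto
qed

text \<open>Tensor products and induced operations are characterized by their properties, so the
  result covers every model of them; the unique existence clauses ensure that the operations and the
  induced map are really determined by their values on pure tensors.\<close>

theorem proposition4p7:
  fixes sL :: "'k::alg_closed_field \<Rightarrow> 'a::ab_group_add \<Rightarrow> 'a"
    and bul :: "'o::ab_semigroup_mult \<Rightarrow> 'a \<Rightarrow> 'a \<Rightarrow> 'a"
    and vee :: "'o \<Rightarrow> 'o \<Rightarrow> 'a \<Rightarrow> 'a \<Rightarrow> 'a"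
    and cur :: "'o \<Rightarrow> 'o \<Rightarrow> 'a \<Rightarrow> 'a \<Rightarrow> 'a \<Rightarrow> 'a"
    and sqr :: "'o \<Rightarrow> 'o \<Rightarrow> 'o \<Rightarrow> 'a \<Rightarrow> 'a \<Rightarrow> 'a \<Rightarrow> 'a"
    and sT :: "'k \<Rightarrow> 't::ab_group_add \<Rightarrow> 't"
    and t :: "'a \<Rightarrow> ('o \<Rightarrow>\<^sub>0 'k) \<Rightarrow> 't"
  assumes "CHAR('k) \<noteq> 2" and "CHAR('k) \<noteq> 3"
    and "ns_lie_yamaguti_family sL bul vee cur sqr"
    and "tensor_product sL free_scale sT t"
  shows
    "(\<exists>!b. induced_bul sT t bul b) \<and> (\<exists>!v. induced_vee sT t vee v) \<and>
     (\<exists>!c. induced_cur sT t cur c) \<and> (\<exists>!s. induced_sqr sT t sqr s) \<and>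
     (\<forall>b v c s.
       induced_bul sT t bul b \<and> induced_vee sT t vee v \<and>
       induced_cur sT t cur c \<and> induced_sqr sT t sqr s \<longrightarrow>
       ns_lie_yamaguti sT b v c s \<and>
       (\<forall>(sL' :: 'k \<Rightarrow> 'b::ab_group_add \<Rightarrow> 'b) bul' vee' cur' sqr' f
         (sT' :: 'k \<Rightarrow> 'u::ab_group_add \<Rightarrow> 'u) t' b' v' c' s'.
         ns_lie_yamaguti_family sL' bul' vee' cur' sqr' \<and>
         ns_lie_yamaguti_family_morphism sL bul vee cur sqr sL' bul' vee' cur' sqr' f \<and>
         tensor_product sL' free_scale sT' t' \<and>
         induced_bul sT' t' bul' b' \<and> induced_vee sT' t' vee' v' \<and>
         induced_cur sT' t' cur' c' \<and> induced_sqr sT' t' sqr' s' \<longrightarrow>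
         (\<exists>!g. induced_map sT t sT' t' f g) \<and>
         (\<forall>g. induced_map sT t sT' t' f g \<longrightarrow>
           ns_lie_yamaguti_morphism sT b v c s sT' b' v' c' s' g)))"
proof -
  interpret family_tensor sL bul vee cur sqr sT t
    using assms(3,4) by (simp add: family_tensor_def free_tensor_def)
  have induced: "induced_algebra sL bul vee cur sqr sT t b v c s"
    if "induced_bul sT t bul b" "induced_vee sT t vee v" "induced_cur sT t cur c"
      "induced_sqr sT t sqr s" for b v c s
    by unfold_locales (use that in auto)
  have morphism: "(\<exists>!g. induced_map sT t sT' t' f g) \<and>
      (\<forall>g. induced_map sT t sT' t' f g \<longrightarrow> ns_lie_yamaguti_morphism sT b v c s sT' b' v' c' s' g)"
    if "induced_bul sT t bul b" "induced_vee sT t vee v" "induced_cur sT t cur c"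
      "induced_sqr sT t sqr s"
      and "ns_lie_yamaguti_family sL' bul' vee' cur' sqr'"
      and f: "ns_lie_yamaguti_family_morphism sL bul vee cur sqr sL' bul' vee' cur' sqr' f"
      and "tensor_product sL' free_scale sT' t'"
      and "induced_bul sT' t' bul' b'" "induced_vee sT' t' vee' v'" "induced_cur sT' t' cur' c'"
      "induced_sqr sT' t' sqr' s'"
    for b v c s and sL' :: "'k \<Rightarrow> 'b \<Rightarrow> 'b" and bul' vee' cur' sqr' f
      and sT' :: "'k \<Rightarrow> 'u \<Rightarrow> 'u" and t' b' v' c' s'
  proof -
    have ft: "free_tensor sL' sT' t'" using that by (simp add: free_tensor_def)
    have "induced_algebra sL' bul' vee' cur' sqr' sT' t' b' v' c' s'"
      using that ft
      by (simp add: induced_algebra_def induced_algebra_axioms_def family_tensor_def)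
    moreover have "Vector_Spaces.linear sL sL' f"
      using f by (simp add: ns_lie_yamaguti_family_morphism_def)
    \<comment> \<open>Linearity of \<open>f\<close> gives the unique induced map, and
      \<open>induced_morphism\<close> applied to the two induced algebras gives its compatibility
      with the operations.\<close>
    ultimately show ?thesis
      using induced_morphism[OF f induced[OF that(1-4)]] ex1_induced_map[OF ft] by blast
  qed
  show ?thesis
    by (intro conjI[OF ex1_induced_bul] conjI[OF ex1_induced_vee] conjI[OF ex1_induced_cur]
        conjI[OF ex1_induced_sqr] allI impI, elim conjE,
        rule conjI[OF induced_algebra.ns_lie_yamaguti[OF induced]], assumption+,
        intro allI impI, elim conjE, rule morphism; assumption)
qed

end
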